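(* Each of the following functions of $x\in(0,1)$ admits a strong simulation (i.e., is strongly realizable): \[ e^{-x},\quad e^{x-1},\quad (1-x)e^x,\quad xe^{1-x}, \] \[ \frac{x}{\log(1-x)^{-1}},\quad \frac{1-x}{\log(1/x)},\quad (1-x)\log\frac{1}{1-x},\quad x\log\frac1x, \] \[ \cos(x),\quad \frac{1-x}{\cos(x)},\quad \frac{x}{\tan(x)},\quad (1-x)\tan(x). \]
   Context: A Buffon machine is a deterministic device belonging to a computationally universal class (Turing machines or, equivalently, register machines), equipped with an external source of independent uniform random bits (each call to this source is a ``flip'') and with input--output queues capable of storing integers, and which is assumed to halt with probability $1$. A function $\lambda\mapsto\phi(\lambda)$, defined for $\lambda\in(0,1)$ and with values in $(0,1)$, is weakly realizable if there is a machine $\mathcal M$ (one machine for all $\lambda$) which, when provided on its input with a perfect generator of independent Bernoulli variables of unknown parameter $\lambda$ (a source of independent $\{0,1\}$-values, each equal to $1$ with probability $\lambda$), outputs, with probability $1$, a Bernoulli random variable of parameter $\phi(\lambda)$. It is strongly realizable (equivalently, it admits a strong simulation) if moreover the random number $C\equiv C(\lambda)$ of coin flips has exponential tails, i.e., there are constants $K$ and $\rho<1$ such that $\Pr(C>m)\le K\rho^m$ for all $m$. *)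

theory Defs
  imports "HOL-Probability.Probability"
begin

text \<open>
  The universal class of deterministic devices is that of unlimited register machines (zero,
  successor, transfer, conditional jump), extended by instructions for the fair-bit source, the
  input queue and the output queue.  \<open>Jump m n q\<close> continues at instruction \<open>q\<close> iff registers \<open>m\<close>
  and \<open>n\<close> have equal contents; instructions are numbered from 0.
\<close>

datatype instr =
    Zero nat
  | Succ nat
  | Transfer nat nat
  | Jump nat nat nat
  | Flip nat
  | Read nat
  | Write nat

type_synonym machine = "instr list"

text \<open>
  \<open>bits\<close> and \<open>inqueue\<close> are the values that the fair-bit source and the Bernoulli generator on the
  input have still to deliver; \<open>calls\<close> is the number of values obtained so far from both of them.
\<close>

record config =
  pc :: nat
  regs :: "nat \<Rightarrow> nat"
  bits :: "bool stream"
  inqueue :: "bool stream"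
  outqueue :: "nat list"
  calls :: nat

primrec exec :: "instr \<Rightarrow> config \<Rightarrow> config" where
  "exec (Zero r) c = c\<lparr>pc := Suc (pc c), regs := (regs c)(r := 0)\<rparr>"
| "exec (Succ r) c = c\<lparr>pc := Suc (pc c), regs := (regs c)(r := Suc (regs c r))\<rparr>"
| "exec (Transfer m n) c = c\<lparr>pc := Suc (pc c), regs := (regs c)(n := regs c m)\<rparr>"
| "exec (Jump m n q) c = c\<lparr>pc := (if regs c m = regs c n then q else Suc (pc c))\<rparr>"
| "exec (Flip r) c = c\<lparr>pc := Suc (pc c), regs := (regs c)(r := of_bool (shd (bits c))),
     bits := stl (bits c), calls := Suc (calls c)\<rparr>"
| "exec (Read r) c = c\<lparr>pc := Suc (pc c), regs := (regs c)(r := of_bool (shd (inqueue c))),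
     inqueue := stl (inqueue c), calls := Suc (calls c)\<rparr>"
| "exec (Write r) c = c\<lparr>pc := Suc (pc c), outqueue := outqueue c @ [regs c r]\<rparr>"

definition halted :: "machine \<Rightarrow> config \<Rightarrow> bool" where
  "halted P c \<longleftrightarrow> length P \<le> pc c"

definition step :: "machine \<Rightarrow> config \<Rightarrow> config" where
  "step P c = (if halted P c then c else exec (P ! pc c) c)"

definition init :: "bool stream \<times> bool stream \<Rightarrow> config" where
  "init \<omega> = \<lparr>pc = 0, regs = (\<lambda>_. 0), bits = fst \<omega>, inqueue = snd \<omega>, outqueue = [], calls = 0\<rparr>"

definition run :: "machine \<Rightarrow> bool stream \<times> bool stream \<Rightarrow> nat \<Rightarrow> config" where
  "run P \<omega> k = (step P ^^ k) (init \<omega>)"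

definition halts_with :: "machine \<Rightarrow> bool stream \<times> bool stream \<Rightarrow> nat list \<Rightarrow> bool" where
  "halts_with P \<omega> ys \<longleftrightarrow> (\<exists>k. halted P (run P \<omega> k) \<and> outqueue (run P \<omega> k) = ys)"

text \<open>
  The number \<open>C\<close> of coin flips counts the fair bits as well as the values drawn from the Bernoulli
  generator, i.e. the flips of both coins.
\<close>

definition coin_flips :: "machine \<Rightarrow> bool stream \<times> bool stream \<Rightarrow> enat" where
  "coin_flips P \<omega> = (SUP k. enat (calls (run P \<omega> k)))"

definition sources :: "real \<Rightarrow> (bool stream \<times> bool stream) measure" where
  "sources p = stream_space (measure_pmf (bernoulli_pmf (1/2)))
     \<Otimes>\<^sub>M stream_space (measure_pmf (bernoulli_pmf p))"

definition weak_simulation :: "machine \<Rightarrow> (real \<Rightarrow> real) \<Rightarrow> bool" where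
  "weak_simulation P \<phi> \<longleftrightarrow> (\<forall>p\<in>{0<..<1}.
     (AE \<omega> in sources p. halts_with P \<omega> [0] \<or> halts_with P \<omega> [1]) \<and>
     measure (sources p) {\<omega> \<in> space (sources p). halts_with P \<omega> [1]} = \<phi> p)"

text \<open>
  The constants in the tail bound may depend on the parameter of the Bernoulli generator, as the
  law of \<open>C\<close> does; the machine may not.
\<close>

definition exponential_tails :: "machine \<Rightarrow> bool" where
  "exponential_tails P \<longleftrightarrow> (\<forall>p\<in>{0<..<1}. \<exists>K \<rho>. 0 < \<rho> \<and> \<rho> < 1 \<and>
     (\<forall>m::nat. measure (sources p) {\<omega> \<in> space (sources p). enat m < coin_flips P \<omega>} \<le> K * \<rho> ^ m))"

definition weakly_realizable :: "(real \<Rightarrow> real) \<Rightarrow> bool" where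
  "weakly_realizable \<phi> \<longleftrightarrow> \<phi> \<in> {0<..<1} \<rightarrow> {0<..<1} \<and> (\<exists>P. weak_simulation P \<phi>)"

definition strongly_realizable :: "(real \<Rightarrow> real) \<Rightarrow> bool" where
  "strongly_realizable \<phi> \<longleftrightarrow>
     \<phi> \<in> {0<..<1} \<rightarrow> {0<..<1} \<and> (\<exists>P. weak_simulation P \<phi> \<and> exponential_tails P)"

end

theory Submission
  imports Defs
begin

text \<open>
  Each function is the acceptance probability of a small flowchart that reads the unknown coin,
  flips a fair coin and keeps one counter.  Its basic move at level \<open>n\<close> is: read the coin; on a
  head (probability \<open>x\<close>), increase the counter and toss a coin of bias \<open>1 / (n + 1)\<close>; go on to level
  \<open>n + 1\<close> only if that toss succeeds as well.  Level \<open>n\<close> is then reached with probability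
  \<open>x ^ n / n!\<close>, and a flowchart that outputs \<open>\<tau> n\<close> when it stops at level \<open>n\<close> accepts with
  probability \<open>\<Sum>n. x ^ n / n! * (\<tau> n - \<tau> (n - 1))\<close>, by Abel summation
  (with \<open>\<tau> (- 1)\<close> read as 0).  With \<open>\<tau>\<close> of period 4 this
  gives \<open>exp (- x)\<close>, \<open>cos x\<close> and \<open>sin x\<close>: negative coefficients come from the parity of the stopping
  level.  The other functions use the same mechanism with small changes.

  \<^item> Accepting exactly when the coin shows tails, and rejecting when the rational coin fails, gives
  \<open>(1 - x) * exp x\<close>.  With coins of bias \<open>n / (n + 1)\<close> for \<open>n > 0\<close> instead, and rejection at level 0,
  it gives \<open>(1 - x) * ln (1 / (1 - x))\<close>.
  \<^item> Quotients come from restarting.  If one round accepts with probability \<open>a\<close> and restarts with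
  probability \<open>b\<close>, the result is the solution \<open>z\<close> of \<open>z = a + b * z\<close>.  So \<open>a = 1 - x\<close> and
  \<open>b = 1 - cos x\<close> give \<open>(1 - x) / cos x\<close>; a run of the sine flowchart appended to it gives
  \<open>(1 - x) * tan x\<close>; and repeating the logarithmic flowchart until it accepts and asking whether it
  stopped at level 1 gives \<open>x / ln (1 / (1 - x))\<close>.
  \<^item> For \<open>x / tan x = cos x / (sin x / x)\<close> a fair coin selects an event of probability \<open>cos x\<close>, which
  outputs 1, or one of probability \<open>sin x / x - cos x\<close>, which outputs 0; if the selected event does
  not occur, everything restarts.  The second event has the series
  \<open>\<Sum>k\<ge>1. (- 1) ^ (k + 1) * x ^ (2 * k) * (2 * k) / (2 * k + 1)!\<close>, which is the same level process with
  the denominators taken in the order \<open>1, 3, 2, 5, 4, 7, 6, \<dots>\<close>.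
  \<^item> Exchanging heads and tails replaces \<open>x\<close> by \<open>1 - x\<close>.

  A coin of rational bias \<open>c / D\<close> is tossed by comparing fair bits with the binary expansion of
  \<open>c / D\<close> until they differ, so each of its flips is the last one with probability 1/2.  Together
  with the fact that from every node of these flowcharts some short sequence of outcomes leads to an
  output, this bounds below the probability of stopping within boundedly many flips, whatever the
  counter contains, and gives exponential tails (\<open>descending_alive\<close>).  The long computations with the
  counter cost machine steps but no flips.

  A flowchart is compiled to a register machine (\<open>simulation\<close>), its acceptance probabilities satisfy
  the one-step equations (\<open>chance_Inl\<close>, \<open>chance_Query\<close>, \<open>chance_Coin\<close>), and solving these by
  Horner's scheme (\<open>horner_sums\<close>, \<open>cycle_sums\<close>) identifies the functions.
\<close>

section \<open>The two sources of random bits\<close>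

lemma prob_space_sources: "prob_space (sources p)"
proof -
  have "prob_space (stream_space (measure_pmf (bernoulli_pmf q)))" for q
    by (rule prob_space.prob_space_stream_space) (rule prob_space_measure_pmf)
  then show ?thesis
    unfolding sources_def by (intro prob_space_pair)
qed

lemma space_sources [simp]: "space (sources p) = UNIV"
  by (simp add: sources_def space_pair_measure space_stream_space)

fun draw :: "bool \<Rightarrow> bool stream \<times> bool stream \<Rightarrow> bool" where
  "draw False \<omega> = shd (fst \<omega>)"
| "draw True \<omega> = shd (snd \<omega>)"

fun rest :: "bool \<Rightarrow> bool stream \<times> bool stream \<Rightarrow> bool stream \<times> bool stream" where
  "rest False \<omega> = (stl (fst \<omega>), snd \<omega>)"
| "rest True \<omega> = (fst \<omega>, stl (snd \<omega>))"

definition bias :: "real \<Rightarrow> bool \<Rightarrow> real" where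
  "bias p i = (if i then p else 1/2)"

lemma bias_bounds: "0 < p \<Longrightarrow> p < 1 \<Longrightarrow> 0 < bias p i \<and> bias p i < 1"
  by (simp add: bias_def)

lemma measurable_draw [measurable]: "draw i \<in> measurable (sources p) (count_space UNIV)"
proof -
  have "shd \<in> measurable (stream_space (measure_pmf (bernoulli_pmf q))) (count_space UNIV)" for q
    by (rule measurable_compose[OF measurable_shd]) simp
  note [measurable] = this
  have "draw False = (\<lambda>\<omega>. shd (fst \<omega>))" "draw True = (\<lambda>\<omega>. shd (snd \<omega>))"
    by auto
  then show ?thesis
    unfolding sources_def by (cases i) simp_all
qed

lemma measurable_rest [measurable]: "rest i \<in> measurable (sources p) (sources p)"
proof -
  have "rest False = (\<lambda>\<omega>. (stl (fst \<omega>), snd \<omega>))" "rest True = (\<lambda>\<omega>. (fst \<omega>, stl (snd \<omega>)))"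
    by auto
  then show ?thesis
    unfolding sources_def by (cases i) simp_all
qed

lemma nn_integral_bernoulli_stream:
  assumes p: "0 < p" "p < 1"
    and f [measurable]: "f \<in> borel_measurable (stream_space (measure_pmf (bernoulli_pmf p)))"
  shows "(\<integral>\<^sup>+X. f X \<partial>stream_space (measure_pmf (bernoulli_pmf p))) =
     ennreal p * (\<integral>\<^sup>+X. f (True ## X) \<partial>stream_space (measure_pmf (bernoulli_pmf p))) +
     ennreal (1 - p) * (\<integral>\<^sup>+X. f (False ## X) \<partial>stream_space (measure_pmf (bernoulli_pmf p)))"
  using p
  by (subst prob_space.nn_integral_stream_space[OF prob_space_measure_pmf f])
     (simp add: mult.commute)

text \<open>
  Fubini's theorem brings the queried source to the inside, where its stream splits off its first
  bit; so both sources obey the same rule.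
\<close>

lemma nn_integral_sources:
  assumes p: "0 < p" "p < 1" and g: "\<And>b. g b \<in> borel_measurable (sources p)"
  shows "(\<integral>\<^sup>+\<omega>. g (draw i \<omega>) (rest i \<omega>) \<partial>sources p) =
    ennreal (bias p i) * (\<integral>\<^sup>+\<omega>. g True \<omega> \<partial>sources p) +
    ennreal (1 - bias p i) * (\<integral>\<^sup>+\<omega>. g False \<omega> \<partial>sources p)"
proof -
  define A where "A = stream_space (measure_pmf (bernoulli_pmf (1/2)))"
  define B where "B = stream_space (measure_pmf (bernoulli_pmf p))"
  have S: "sources p = A \<Otimes>\<^sub>M B"
    by (simp add: sources_def A_def B_def)
  have "prob_space A" "prob_space B"
    unfolding A_def B_def by (auto intro!: prob_space.prob_space_stream_space prob_space_measure_pmf)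
  then interpret A: prob_space A + B: prob_space B .
  interpret AB: pair_sigma_finite A B ..
  have gm [measurable]: "g b \<in> borel_measurable (A \<Otimes>\<^sub>M B)" for b
    using g[of b] by (simp add: S)
  \<comment> \<open>a case distinction on the bit, because \<open>g\<close> is measurable for each value of the bit\<close>
  have meas: "(\<lambda>\<omega>. g (draw i \<omega>) (rest i \<omega>)) \<in> borel_measurable (A \<Otimes>\<^sub>M B)" for i
  proof -
    have "(\<lambda>\<omega>. if draw i \<omega> then g True (rest i \<omega>) else g False (rest i \<omega>))
        \<in> borel_measurable (sources p)"
      using g by measurable
    also have "(\<lambda>\<omega>. if draw i \<omega> then g True (rest i \<omega>) else g False (rest i \<omega>)) =
        (\<lambda>\<omega>. g (draw i \<omega>) (rest i \<omega>))"
      by auto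
    finally show ?thesis by (simp add: S)
  qed
  show ?thesis
  proof (cases i)
    case True
    have "(\<integral>\<^sup>+\<omega>. g (draw i \<omega>) (rest i \<omega>) \<partial>sources p) =
        (\<integral>\<^sup>+\<alpha>. (\<integral>\<^sup>+\<beta>. g (shd \<beta>) (\<alpha>, stl \<beta>) \<partial>B) \<partial>A)"
      using B.nn_integral_fst[OF meas[of True]] by (simp add: S True)
    also have "\<dots> = (\<integral>\<^sup>+\<alpha>. ennreal p * (\<integral>\<^sup>+\<beta>. g True (\<alpha>, \<beta>) \<partial>B) +
        ennreal (1 - p) * (\<integral>\<^sup>+\<beta>. g False (\<alpha>, \<beta>) \<partial>B) \<partial>A)"
    proof (rule nn_integral_cong)
      fix \<alpha> assume "\<alpha> \<in> space A"
      then have "(\<lambda>\<beta>. g (shd \<beta>) (\<alpha>, stl \<beta>)) \<in> borel_measurable B"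
        using measurable_compose[OF measurable_Pair1' meas[of True]] by simp
      from nn_integral_bernoulli_stream[OF p this[unfolded B_def]]
      show "(\<integral>\<^sup>+\<beta>. g (shd \<beta>) (\<alpha>, stl \<beta>) \<partial>B) = ennreal p * (\<integral>\<^sup>+\<beta>. g True (\<alpha>, \<beta>) \<partial>B) +
          ennreal (1 - p) * (\<integral>\<^sup>+\<beta>. g False (\<alpha>, \<beta>) \<partial>B)"
        by (simp add: B_def)
    qed
    also have "\<dots> = ennreal p * (\<integral>\<^sup>+\<alpha>. (\<integral>\<^sup>+\<beta>. g True (\<alpha>, \<beta>) \<partial>B) \<partial>A) +
        ennreal (1 - p) * (\<integral>\<^sup>+\<alpha>. (\<integral>\<^sup>+\<beta>. g False (\<alpha>, \<beta>) \<partial>B) \<partial>A)"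
      by (subst nn_integral_add) (auto simp: nn_integral_cmult)
    finally show ?thesis
      by (simp add: B.nn_integral_fst gm S True bias_def)
  next
    case False
    have "(\<integral>\<^sup>+\<omega>. g (draw i \<omega>) (rest i \<omega>) \<partial>sources p) =
        (\<integral>\<^sup>+\<beta>. (\<integral>\<^sup>+\<alpha>. g (shd \<alpha>) (stl \<alpha>, \<beta>) \<partial>A) \<partial>B)"
      using AB.nn_integral_snd[OF meas[of False]] by (simp add: S False)
    also have "\<dots> = (\<integral>\<^sup>+\<beta>. ennreal (1/2) * (\<integral>\<^sup>+\<alpha>. g True (\<alpha>, \<beta>) \<partial>A) +
        ennreal (1 - 1/2) * (\<integral>\<^sup>+\<alpha>. g False (\<alpha>, \<beta>) \<partial>A) \<partial>B)"
    proof (rule nn_integral_cong)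
      fix \<beta> assume "\<beta> \<in> space B"
      then have "(\<lambda>\<alpha>. g (shd \<alpha>) (stl \<alpha>, \<beta>)) \<in> borel_measurable A"
        using measurable_compose[OF measurable_Pair2' meas[of False]] by simp
      from nn_integral_bernoulli_stream[OF _ _ this[unfolded A_def]]
      show "(\<integral>\<^sup>+\<alpha>. g (shd \<alpha>) (stl \<alpha>, \<beta>) \<partial>A) =
          ennreal (1/2) * (\<integral>\<^sup>+\<alpha>. g True (\<alpha>, \<beta>) \<partial>A) +
          ennreal (1 - 1/2) * (\<integral>\<^sup>+\<alpha>. g False (\<alpha>, \<beta>) \<partial>A)"
        by (simp add: A_def)
    qed
    also have "\<dots> = ennreal (1/2) * (\<integral>\<^sup>+\<beta>. (\<integral>\<^sup>+\<alpha>. g True (\<alpha>, \<beta>) \<partial>A) \<partial>B) +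
        ennreal (1 - 1/2) * (\<integral>\<^sup>+\<beta>. (\<integral>\<^sup>+\<alpha>. g False (\<alpha>, \<beta>) \<partial>A) \<partial>B)"
      by (subst nn_integral_add) (auto simp: nn_integral_cmult)
    finally show ?thesis
      by (simp add: AB.nn_integral_snd gm S False bias_def)
  qed
qed

section \<open>Querying automata\<close>

text \<open>
  A state of an automaton says which source it queries next (\<open>True\<close> for the input generator, \<open>False\<close>
  for the fair bits) and how the answer determines the next state or the output.  Every transition
  costs exactly one call, so the number of transitions before the output is the number of flips.
\<close>

type_synonym 's automaton = "'s \<Rightarrow> bool \<times> (bool \<Rightarrow> 's + bool)"

fun advance :: "'s automaton \<Rightarrow> nat \<Rightarrow> 's + bool \<Rightarrow> bool stream \<times> bool stream \<Rightarrow> 's + bool" where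
  "advance \<delta> 0 x \<omega> = x"
| "advance \<delta> (Suc m) (Inr b) \<omega> = Inr b"
| "advance \<delta> (Suc m) (Inl s) \<omega> =
     advance \<delta> m (snd (\<delta> s) (draw (fst (\<delta> s)) \<omega>)) (rest (fst (\<delta> s)) \<omega>)"

text \<open>
  The expectation of \<open>f\<close> after \<open>m\<close> transitions, written as a recursion over the reals so
  that recurrences and inequalities for it need no measure theory.
\<close>

fun expected :: "real \<Rightarrow> 's automaton \<Rightarrow> ('s + bool \<Rightarrow> real) \<Rightarrow> nat \<Rightarrow> 's + bool \<Rightarrow> real" where
  "expected p \<delta> f 0 x = f x"
| "expected p \<delta> f (Suc m) (Inr b) = f (Inr b)"
| "expected p \<delta> f (Suc m) (Inl s) =
     bias p (fst (\<delta> s)) * expected p \<delta> f m (snd (\<delta> s) True) +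
     (1 - bias p (fst (\<delta> s))) * expected p \<delta> f m (snd (\<delta> s) False)"

lemma advance_Inr [simp]: "advance \<delta> m (Inr b) \<omega> = Inr b"
  by (cases m) simp_all

lemma expected_Inr [simp]: "expected p \<delta> f m (Inr b) = f (Inr b)"
  by (cases m) simp_all

lemma expected_mono:
  assumes "0 < p" "p < 1" "\<And>x. f x \<le> g x"
  shows "expected p \<delta> f m x \<le> expected p \<delta> g m x"
  using assms
  by (induction p \<delta> f m x rule: expected.induct)
     (auto intro!: add_mono mult_left_mono simp: less_imp_le[OF bias_bounds[THEN conjunct1]]
        less_imp_le[OF bias_bounds[THEN conjunct2]])

lemma expected_const: "expected p \<delta> (\<lambda>_. c) m x = c"
  by (induction p \<delta> "\<lambda>_::'a + bool. c" m x rule: expected.induct) (auto simp: algebra_simps)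

lemma measurable_advance [measurable]:
  "advance \<delta> m x \<in> measurable (sources p) (count_space UNIV)"
proof (induction m arbitrary: x)
  case (Suc m)
  note [measurable] = Suc.IH
  show ?case
  proof (cases x)
    case (Inl s)
    have "advance \<delta> (Suc m) x = (\<lambda>\<omega>. if draw (fst (\<delta> s)) \<omega>
        then advance \<delta> m (snd (\<delta> s) True) (rest (fst (\<delta> s)) \<omega>)
        else advance \<delta> m (snd (\<delta> s) False) (rest (fst (\<delta> s)) \<omega>))"
      by (auto simp: Inl)
    also have "\<dots> \<in> measurable (sources p) (count_space UNIV)"
      by measurable
    finally show ?thesis .
  next
    case (Inr b)
    then have "advance \<delta> (Suc m) x = (\<lambda>_. Inr b)" by auto
    then show ?thesis by simp
  qed
qed (simp del: advance.simps add: advance.simps(1)[abs_def])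

lemma sets_advance: "{\<omega>. advance \<delta> m x \<omega> \<in> A} \<in> sets (sources p)"
  using measurable_sets[OF measurable_advance, of A \<delta> m x p] by (simp add: vimage_def)

lemma emeasure_advance:
  assumes p: "0 < p" "p < 1"
  shows "emeasure (sources p) {\<omega>. advance \<delta> m x \<omega> \<in> A} = ennreal (expected p \<delta> (indicator A) m x)"
proof -
  interpret prob_space "sources p" by (rule prob_space_sources)
  have "(\<integral>\<^sup>+\<omega>. indicator A (advance \<delta> m x \<omega>) \<partial>sources p) = ennreal (expected p \<delta> (indicator A) m x)"
  proof (induction m arbitrary: x)
    case 0
    show ?case by (simp add: emeasure_space_1[simplified] indicator_def)
  next
    case (Suc m)
    have nn: "0 \<le> expected p \<delta> (indicator A) k y" for k y
      using expected_mono[OF p, of "\<lambda>_. 0" "indicator A" \<delta> k y] by (simp add: expected_const)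
    show ?case
    proof (cases x)
      case (Inl s)
      define i where "i = fst (\<delta> s)"
      have "(\<integral>\<^sup>+\<omega>. indicator A (advance \<delta> (Suc m) x \<omega>) \<partial>sources p) =
          (\<integral>\<^sup>+\<omega>. (\<lambda>b \<omega>. indicator A (advance \<delta> m (snd (\<delta> s) b) \<omega>)) (draw i \<omega>) (rest i \<omega>) \<partial>sources p)"
        by (simp add: Inl i_def)
      also have "\<dots> = ennreal (bias p i) * ennreal (expected p \<delta> (indicator A) m (snd (\<delta> s) True)) +
          ennreal (1 - bias p i) * ennreal (expected p \<delta> (indicator A) m (snd (\<delta> s) False))"
        by (subst nn_integral_sources[OF p]) (auto simp: Suc.IH intro: measurable_compose[OF measurable_advance])
      also have "\<dots> = ennreal (expected p \<delta> (indicator A) (Suc m) x)"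
        using bias_bounds[OF p, of i] nn
        by (simp add: Inl i_def[symmetric] ennreal_mult'[symmetric] ennreal_plus[symmetric] del: ennreal_plus)
      finally show ?thesis .
    next
      case (Inr b)
      then show ?thesis by (simp add: emeasure_space_1[simplified] indicator_def)
    qed
  qed
  also have "(\<integral>\<^sup>+\<omega>. indicator A (advance \<delta> m x \<omega>) \<partial>sources p) =
      (\<integral>\<^sup>+\<omega>. indicator {\<omega>. advance \<delta> m x \<omega> \<in> A} \<omega> \<partial>sources p)"
    by (simp add: indicator_def)
  also have "\<dots> = emeasure (sources p) {\<omega>. advance \<delta> m x \<omega> \<in> A}"
    by (rule nn_integral_indicator) (rule sets_advance)
  finally show ?thesis by simp
qed

lemma measure_advance:
  assumes p: "0 < p" "p < 1"
  shows "measure (sources p) {\<omega>. advance \<delta> m x \<omega> \<in> A} = expected p \<delta> (indicator A) m x"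
proof -
  have "0 \<le> expected p \<delta> (indicator A) m x"
    using expected_mono[OF p, of "\<lambda>_. 0" "indicator A" \<delta> m x] by (simp add: expected_const)
  then show ?thesis
    by (simp add: measure_def emeasure_advance[OF p])
qed

lemma advance_add: "advance \<delta> m x \<omega> = Inr b \<Longrightarrow> advance \<delta> (m + k) x \<omega> = Inr b"
  by (induction \<delta> m x \<omega> rule: advance.induct) auto

lemma advance_le: "advance \<delta> m x \<omega> = Inr b \<Longrightarrow> m \<le> n \<Longrightarrow> advance \<delta> n x \<omega> = Inr b"
  using advance_add[of \<delta> m x \<omega> b "n - m"] by simp

text \<open>
  As a limit of \<open>expected\<close>, the probability of accepting satisfies the one-step equations
  \<open>chance_Inl\<close>.  These may have several solutions; being a probability, \<open>chance\<close> is a bounded one,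
  and this boundedness is what singles it out later.
\<close>

definition chance :: "real \<Rightarrow> 's automaton \<Rightarrow> 's + bool \<Rightarrow> real" where
  "chance p \<delta> x = measure (sources p) {\<omega>. \<exists>m. advance \<delta> m x \<omega> = Inr True}"

lemma expected_tendsto_chance:
  assumes p: "0 < p" "p < 1"
  shows "(\<lambda>m. expected p \<delta> (indicator {Inr True}) m x) \<longlonglongrightarrow> chance p \<delta> x"
proof -
  interpret prob_space "sources p" by (rule prob_space_sources)
  define A where "A m = {\<omega>. advance \<delta> m x \<omega> \<in> {Inr True}}" for m
  have "(\<lambda>m. measure (sources p) (A m)) \<longlonglongrightarrow> measure (sources p) (\<Union>m. A m)"
  proof (rule finite_Lim_measure_incseq)
    show "range A \<subseteq> sets (sources p)"
      unfolding A_def by (rule image_subsetI) (rule sets_advance)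
    show "incseq A"
      by (auto simp: A_def incseq_def intro: advance_le)
  qed
  moreover have "(\<Union>m. A m) = {\<omega>. \<exists>m. advance \<delta> m x \<omega> = Inr True}"
    by (auto simp: A_def)
  ultimately show ?thesis
    by (simp add: A_def[abs_def] measure_advance[OF p, of \<delta> _ x "{Inr True}", simplified] chance_def)
qed

lemma chance_bounds: "0 \<le> chance p \<delta> x" "chance p \<delta> x \<le> 1"
  using prob_space.prob_le_1[OF prob_space_sources] by (auto simp: chance_def)

lemma chance_Inr:
  assumes "0 < p" "p < 1"
  shows "chance p \<delta> (Inr b) = of_bool b"
proof -
  have "(\<lambda>m. of_bool b) \<longlonglongrightarrow> chance p \<delta> (Inr b)"
    using expected_tendsto_chance[OF assms, of \<delta> "Inr b"] by (cases b) simp_all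
  then show ?thesis by (simp add: LIMSEQ_const_iff)
qed

lemma chance_Inl:
  assumes p: "0 < p" "p < 1"
  shows "chance p \<delta> (Inl s) = bias p (fst (\<delta> s)) * chance p \<delta> (snd (\<delta> s) True) +
    (1 - bias p (fst (\<delta> s))) * chance p \<delta> (snd (\<delta> s) False)"
proof -
  have "(\<lambda>m. expected p \<delta> (indicator {Inr True}) (Suc m) (Inl s)) \<longlonglongrightarrow>
      bias p (fst (\<delta> s)) * chance p \<delta> (snd (\<delta> s) True) +
      (1 - bias p (fst (\<delta> s))) * chance p \<delta> (snd (\<delta> s) False)"
    unfolding expected.simps by (intro tendsto_intros expected_tendsto_chance[OF p])
  moreover have "(\<lambda>m. expected p \<delta> (indicator {Inr True}) (Suc m) (Inl s)) \<longlonglongrightarrow> chance p \<delta> (Inl s)"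
    by (rule LIMSEQ_Suc[OF expected_tendsto_chance[OF p]])
  ultimately show ?thesis by (rule LIMSEQ_unique[symmetric])
qed

text \<open>
  The supermartingale argument for tails: if one transition shrinks the expectation of \<open>f\<close> by the
  factor \<open>\<rho>\<close>, then \<open>m\<close> transitions shrink it by \<open>\<rho> ^ m\<close>.
\<close>

lemma expected_contraction:
  assumes p: "0 < p" "p < 1" and \<rho>: "0 < \<rho>"
    and f: "\<And>s. bias p (fst (\<delta> s)) * f (snd (\<delta> s) True) +
        (1 - bias p (fst (\<delta> s))) * f (snd (\<delta> s) False) \<le> \<rho> * f (Inl s)"
    and fR: "\<And>b. f (Inr b) = 0"
  shows "expected p \<delta> f m x \<le> \<rho> ^ m * f x"
proof (induction m arbitrary: x)
  case (Suc m)
  show ?case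
  proof (cases x)
    case (Inl s)
    have "expected p \<delta> f (Suc m) x \<le> bias p (fst (\<delta> s)) * (\<rho> ^ m * f (snd (\<delta> s) True)) +
        (1 - bias p (fst (\<delta> s))) * (\<rho> ^ m * f (snd (\<delta> s) False))"
      unfolding Inl expected.simps
      using bias_bounds[OF p, of "fst (\<delta> s)"] by (intro add_mono mult_left_mono Suc.IH) auto
    also have "\<dots> = \<rho> ^ m * (bias p (fst (\<delta> s)) * f (snd (\<delta> s) True) +
        (1 - bias p (fst (\<delta> s))) * f (snd (\<delta> s) False))"
      by (simp add: algebra_simps)
    also have "\<dots> \<le> \<rho> ^ m * (\<rho> * f (Inl s))"
      using \<rho> by (intro mult_left_mono f) auto
    finally show ?thesis by (simp add: Inl algebra_simps)
  qed (simp add: fR)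
qed simp

text \<open>
  A rank that one of the two possible answers always decreases, unless that answer ends the
  computation.  The rank may well increase after the other answer, as it does at a restart.
\<close>

definition descends :: "'s automaton \<Rightarrow> ('s \<Rightarrow> nat) \<Rightarrow> bool" where
  "descends \<delta> r \<longleftrightarrow> (\<forall>s. \<exists>b. case snd (\<delta> s) b of Inl t \<Rightarrow> r t < r s | Inr _ \<Rightarrow> True)"

text \<open>
  If the ranks are bounded by \<open>R\<close>, then from every state a run of at most \<open>R + 1\<close> favourable answers
  produces an output, and each answer is favourable with probability at least \<open>\<epsilon>\<close>.  The function
  \<open>2 - \<eta> ^ (r s + 1)\<close>, extended by 0 to outputs, turns this into a contraction: its values lie
  between 1 and 2, and with \<open>\<eta> = \<epsilon> / 2\<close> the gain \<open>\<epsilon> * \<eta> ^ r s\<close> from a decrease of the rank is twice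
  the deficit \<open>\<eta> ^ (r s + 1)\<close> of the present state.
\<close>

lemma descending_alive:
  assumes p: "0 < p" "p < 1" and r: "descends \<delta> r" "\<And>s. r s \<le> R"
  obtains \<rho> where "0 < \<rho>" "\<rho> < 1"
    "\<And>m x. expected p \<delta> (indicator (range Inl)) m x \<le> 2 * \<rho> ^ m"
proof -
  define \<epsilon> where "\<epsilon> = min (1/2) (min p (1 - p))"
  define \<eta> where "\<eta> = \<epsilon> / 2"
  define \<rho> where "\<rho> = 1 - \<eta> ^ Suc R / 2"
  define f where "f x = (case x of Inl s \<Rightarrow> 2 - \<eta> ^ Suc (r s) | Inr _ \<Rightarrow> 0)" for x :: "'a + bool"
  have \<epsilon>: "0 < \<epsilon>" "\<epsilon> \<le> 1/2" "\<epsilon> \<le> bias p i" "\<epsilon> \<le> 1 - bias p i" for i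
    using p by (auto simp: \<epsilon>_def bias_def min_def)
  have \<eta>: "0 < \<eta>" "\<eta> \<le> 1" "\<epsilon> = 2 * \<eta>"
    using \<epsilon> by (auto simp: \<eta>_def)
  have pow: "0 < \<eta> ^ n" "\<eta> ^ n \<le> 1" for n
    using \<eta> by (auto simp: power_le_one)
  have \<rho>: "0 < \<rho>" "\<rho> < 1"
    using pow[of "Suc R"] by (auto simp: \<rho>_def simp del: power_Suc)
  have f2: "f x \<le> 2" for x
    using pow by (auto simp: f_def less_imp_le simp del: power_Suc split: sum.splits)
  have f1: "indicator (range Inl) x \<le> f x" for x
    using pow by (auto simp: f_def indicator_def simp del: power_Suc split: sum.splits)
  have contr: "bias p (fst (\<delta> s)) * f (snd (\<delta> s) True) +
        (1 - bias p (fst (\<delta> s))) * f (snd (\<delta> s) False) \<le> \<rho> * f (Inl s)" for s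
  proof -
    obtain b where b: "case snd (\<delta> s) b of Inl t \<Rightarrow> r t < r s | Inr _ \<Rightarrow> True"
      using r(1) unfolding descends_def by blast
    define q where "q = (if b then bias p (fst (\<delta> s)) else 1 - bias p (fst (\<delta> s)))"
    have q: "\<epsilon> \<le> q" "q \<le> 1"
      using \<epsilon> bias_bounds[OF p, of "fst (\<delta> s)"] by (auto simp: q_def)
    have drop: "f (snd (\<delta> s) b) \<le> 2 - \<eta> ^ r s"
    proof (cases "snd (\<delta> s) b")
      case (Inl t)
      then have "\<eta> ^ r s \<le> \<eta> ^ Suc (r t)"
        using b \<eta> by (intro power_decreasing) auto
      then show ?thesis by (simp add: f_def Inl)
    qed (use pow[of "r s"] in \<open>simp add: f_def\<close>)
    have "bias p (fst (\<delta> s)) * f (snd (\<delta> s) True) + (1 - bias p (fst (\<delta> s))) * f (snd (\<delta> s) False) =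
        q * f (snd (\<delta> s) b) + (1 - q) * f (snd (\<delta> s) (\<not> b))"
      by (cases b) (simp_all add: q_def)
    also have "\<dots> \<le> q * (2 - \<eta> ^ r s) + (1 - q) * 2"
      using q \<epsilon> by (intro add_mono mult_left_mono drop f2) auto
    also have "\<dots> = 2 - q * \<eta> ^ r s"
      by (simp add: algebra_simps)
    also have "\<dots> \<le> 2 - \<epsilon> * \<eta> ^ r s"
      using q pow[of "r s"] by (simp add: mult_right_mono)
    also have "\<dots> = 2 - 2 * \<eta> ^ Suc (r s)"
      by (simp add: \<eta>)
    also have "\<dots> \<le> \<rho> * (2 - \<eta> ^ Suc (r s))"
    proof -
      define t where "t = \<eta> ^ Suc (r s)"
      have t: "0 < t" "t \<le> 1"
        using pow[of "Suc (r s)"] by (auto simp: t_def)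
      have "\<eta> ^ Suc R \<le> t"
        unfolding t_def using \<eta> r(2)[of s] by (intro power_decreasing) auto
      then have "1 - t / 2 \<le> \<rho>"
        by (simp add: \<rho>_def)
      then have "(1 - t / 2) * (2 - t) \<le> \<rho> * (2 - t)"
        using t by (intro mult_right_mono) auto
      moreover have "2 - 2 * t \<le> (1 - t / 2) * (2 - t)"
        by (simp add: algebra_simps)
      ultimately show ?thesis by (simp add: t_def)
    qed
    finally show ?thesis by (simp add: f_def)
  qed
  have "expected p \<delta> (indicator (range Inl)) m x \<le> 2 * \<rho> ^ m" for m x
  proof -
    have "expected p \<delta> (indicator (range Inl)) m x \<le> expected p \<delta> f m x"
      by (rule expected_mono[OF p f1])
    also have "\<dots> \<le> \<rho> ^ m * f x"
      by (rule expected_contraction[OF p \<rho>(1) contr]) (simp add: f_def)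
    also have "\<dots> \<le> \<rho> ^ m * 2"
      using \<rho> by (intro mult_left_mono f2) auto
    finally show ?thesis by simp
  qed
  with \<rho> show thesis by (rule that)
qed

lemma descending_AE_halts:
  assumes p: "0 < p" "p < 1" and r: "descends \<delta> r" "\<And>s. r s \<le> R"
  shows "AE \<omega> in sources p. \<exists>m b. advance \<delta> m x \<omega> = Inr b"
proof -
  interpret prob_space "sources p" by (rule prob_space_sources)
  obtain \<rho> where \<rho>: "0 < \<rho>" "\<rho> < 1"
    "\<And>m x. expected p \<delta> (indicator (range Inl)) m x \<le> 2 * \<rho> ^ m"
    using descending_alive[OF p r] by blast
  define N where "N = (\<Inter>m. {\<omega>. advance \<delta> m x \<omega> \<in> range Inl})"
  have N: "N \<in> sets (sources p)"
    unfolding N_def by (intro sets.countable_INT) (auto intro: sets_advance)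
  have "measure (sources p) N \<le> 2 * \<rho> ^ m" for m
  proof -
    have "measure (sources p) N \<le> measure (sources p) {\<omega>. advance \<delta> m x \<omega> \<in> range Inl}"
      by (rule finite_measure_mono) (auto simp: N_def intro: sets_advance)
    also have "\<dots> \<le> 2 * \<rho> ^ m"
      unfolding measure_advance[OF p] by (rule \<rho>)
    finally show ?thesis .
  qed
  moreover have "(\<lambda>m. 2 * \<rho> ^ m) \<longlonglongrightarrow> 2 * 0"
    using \<rho> by (intro tendsto_mult tendsto_const LIMSEQ_power_zero) auto
  ultimately have "measure (sources p) N \<le> 2 * 0"
    by (metis LIMSEQ_le_const)
  then have "N \<in> null_sets (sources p)"
    using N by (simp add: null_sets_def emeasure_eq_measure measure_le_0_iff)
  then show ?thesis
  proof (rule AE_I')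
    show "{\<omega> \<in> space (sources p). \<not> (\<exists>m b. advance \<delta> m x \<omega> = Inr b)} \<subseteq> N"
    proof
      fix \<omega> assume *: "\<omega> \<in> {\<omega> \<in> space (sources p). \<not> (\<exists>m b. advance \<delta> m x \<omega> = Inr b)}"
      have "advance \<delta> m x \<omega> \<in> range Inl" for m
        using * by (cases "advance \<delta> m x \<omega>") auto
      then show "\<omega> \<in> N" by (auto simp: N_def)
    qed
  qed
qed

section \<open>A language of flowcharts with one counter\<close>

text \<open>
  Flowcharts act on a counter \<open>n\<close>.  \<open>Query i a b\<close> branches on one value of the source \<open>i\<close>, to \<open>b\<close> if it
  is \<open>True\<close>; \<open>Coin e a b\<close> goes to \<open>b\<close> with probability \<open>1 / n\<close>, or \<open>1 / (n + 2)\<close> if \<open>e\<close> holds, and to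
  \<open>a\<close> otherwise.  The offset 2 serves the permuted denominators of the flowchart for \<open>x / tan x\<close>.
  Changes of the counter are attached to the edges, so that every node makes a call.
\<close>

datatype update = Keep | Incr | Reset

datatype target = Out bool | Goto nat update

datatype node = Query bool target target | Coin bool target target

text \<open>
  The components are the label of the node, the counter, and the numerator of the bias that a
  rational coin has left.  That numerator is 1 on entering a node, for a coin of bias \<open>1 / D\<close>.
\<close>

type_synonym state = "nat \<times> nat \<times> nat"

fun apply_update :: "update \<Rightarrow> nat \<Rightarrow> nat" where
  "apply_update Keep n = n"
| "apply_update Incr n = Suc n"
| "apply_update Reset n = 0"

fun enter :: "nat \<Rightarrow> target \<Rightarrow> state + bool" where
  "enter n (Out b) = Inr b"
| "enter n (Goto l u) = Inl (l, apply_update u n, 1)"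

text \<open>
  One binary digit of \<open>v / D\<close> and the numerator of the remaining fraction, computed by counting:
  \<open>v\<close> ticks of a counter that starts at \<open>v\<close> and wraps around from \<open>D\<close> to 1.  The second component
  records the wrap, i.e. the digit.  The range \<open>{1..D}\<close> instead of \<open>{0..<D}\<close> selects the expansion that
  ends in ones, which also covers the bias \<open>D / D = 1\<close>.
\<close>

fun tick :: "nat \<Rightarrow> nat \<times> nat \<Rightarrow> nat \<times> nat" where
  "tick D (w, c) = (if w = D then (1, 1) else (Suc w, c))"

definition double :: "nat \<Rightarrow> nat \<Rightarrow> nat \<times> nat" where
  "double D v = (tick D ^^ v) (v, 0)"

definition denominator :: "bool \<Rightarrow> nat \<Rightarrow> nat" where
  "denominator e n = (if e then n + 2 else n)"

fun behaviour :: "node \<Rightarrow> state \<Rightarrow> bool \<times> (bool \<Rightarrow> state + bool)" where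
  "behaviour (Query i a b) (l, n, v) = (i, \<lambda>y. enter n (if y then b else a))"
| "behaviour (Coin e a b) (l, n, v) = (False, \<lambda>y. case double (denominator e n) v of (w, c) \<Rightarrow>
     if c = of_bool y then Inl (l, n, w) else enter n (if y then a else b))"

text \<open>
  Outside the program the automaton stops after one flip; with this default the descent condition
  below refers to the nodes of the program alone.
\<close>

definition transition :: "node list \<Rightarrow> state automaton" where
  "transition Q s = (if fst s < length Q then behaviour (Q ! fst s) s else (False, \<lambda>_. Inr False))"

fun target_ok :: "nat \<Rightarrow> target \<Rightarrow> bool" where
  "target_ok L (Out b) = True"
| "target_ok L (Goto l u) = (l < L)"

fun node_ok :: "nat \<Rightarrow> node \<Rightarrow> bool" where
  "node_ok L (Query i a b) = (target_ok L a \<and> target_ok L b)"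
| "node_ok L (Coin e a b) = (target_ok L a \<and> target_ok L b)"

section \<open>Compilation to register machines\<close>

text \<open>
  Every node is compiled to a block of 27 instructions, the length of the code for \<open>Coin\<close>; \<open>loc l i\<close>
  is the address of instruction \<open>i\<close> in block \<open>l\<close>, and \<open>loc (length Q) 0\<close> is the first address after
  the program, where the machine halts.
\<close>

definition loc :: "nat \<Rightarrow> nat \<Rightarrow> nat" where
  "loc l i = 27 * l + i"

text \<open>
  Register 0 is never written and stays 0; it serves for unconditional jumps and for tests against
  0.  Register 1 holds the counter, register 2 the numerator \<open>v\<close>, register 3 the last bit, and in the
  code for \<open>Coin\<close> register 4 holds the denominator, 5 the number of ticks done, 6 and 7 the pair on
  which \<open>tick\<close> acts.
\<close>

fun target_code :: "nat \<Rightarrow> target \<Rightarrow> instr list" where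
  "target_code L (Out b) = [Zero 3, if b then Succ 3 else Zero 3, Write 3, Jump 0 0 (loc L 0)]"
| "target_code L (Goto l u) =
     [case u of Keep \<Rightarrow> Zero 3 | Incr \<Rightarrow> Succ 1 | Reset \<Rightarrow> Zero 1, Zero 2, Succ 2, Jump 0 0 (loc l 0)]"

text \<open>
  In the code for \<open>Coin\<close> the instructions 6 to 14 perform the ticks, and 16 to 18 compare a flip with
  the digit: if they agree, the block starts again with the new numerator; if the digit is 1, the
  toss succeeds (instruction 23); if it is 0, control falls through to the failure code.
\<close>

fun node_code :: "nat \<Rightarrow> nat \<Rightarrow> node \<Rightarrow> instr list" where
  "node_code L l (Query i a b) =
     [if i then Read 3 else Flip 3,
      Jump 3 0 (loc l 6)] @ target_code L b @ target_code L a @ replicate 17 (Zero 3)"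
| "node_code L l (Coin e a b) =
     [Transfer 1 4,
      if e then Succ 4 else Zero 3,
      if e then Succ 4 else Zero 3,
      Zero 5,
      Zero 7,
      Transfer 2 6,
      Jump 5 2 (loc l 15),
      Jump 6 4 (loc l 9),
      Jump 0 0 (loc l 12),
      Zero 6,
      Zero 7,
      Succ 7,
      Succ 6,
      Succ 5,
      Jump 0 0 (loc l 6),
      Transfer 6 2,
      Flip 3,
      Jump 3 7 (loc l 0),
      Jump 3 0 (loc l 23)] @ target_code L a @ target_code L b"

definition compile :: "node list \<Rightarrow> machine" where
  "compile Q = map (\<lambda>j. node_code (length Q) (j div 27) (Q ! (j div 27)) ! (j mod 27))
     [0..<loc (length Q) 0]"

definition cfg :: "nat \<Rightarrow> (nat \<Rightarrow> nat) \<Rightarrow> bool stream \<times> bool stream \<Rightarrow> nat list \<Rightarrow> nat \<Rightarrow> config" where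
  "cfg q r \<omega> out k =
     \<lparr>pc = q, regs = r, bits = fst \<omega>, inqueue = snd \<omega>, outqueue = out, calls = k\<rparr>"

definition reaches :: "machine \<Rightarrow> config \<Rightarrow> config \<Rightarrow> bool" where
  "reaches P c c' \<longleftrightarrow> (\<exists>k. (step P ^^ k) c = c')"

lemma reaches_refl: "reaches P c c"
  unfolding reaches_def by (rule exI[of _ 0]) simp

lemma reaches_step: "reaches P (step P c) c' \<Longrightarrow> reaches P c c'"
  unfolding reaches_def by (metis comp_apply funpow_Suc_right)

lemma reaches_trans: "reaches P a b \<Longrightarrow> reaches P b c \<Longrightarrow> reaches P a c"
  unfolding reaches_def by (metis comp_apply funpow_add)

lemma exec_cfg:
  "exec (Zero x) (cfg (loc l i) r \<omega> out k) = cfg (loc l (Suc i)) (r(x := 0)) \<omega> out k"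
  "exec (Succ x) (cfg (loc l i) r \<omega> out k) = cfg (loc l (Suc i)) (r(x := Suc (r x))) \<omega> out k"
  "exec (Transfer x y) (cfg (loc l i) r \<omega> out k) = cfg (loc l (Suc i)) (r(y := r x)) \<omega> out k"
  "exec (Jump x y j) (cfg (loc l i) r \<omega> out k) =
     cfg (if r x = r y then j else loc l (Suc i)) r \<omega> out k"
  "exec (Flip x) (cfg (loc l i) r \<omega> out k) =
     cfg (loc l (Suc i)) (r(x := of_bool (draw False \<omega>))) (rest False \<omega>) out (Suc k)"
  "exec (Read x) (cfg (loc l i) r \<omega> out k) =
     cfg (loc l (Suc i)) (r(x := of_bool (draw True \<omega>))) (rest True \<omega>) out (Suc k)"
  "exec (Write x) (cfg (loc l i) r \<omega> out k) = cfg (loc l (Suc i)) r \<omega> (out @ [r x]) k"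
  by (simp_all add: cfg_def loc_def)

lemma step_cfg:
  assumes "l < length Q" "i < 27"
  shows "step (compile Q) (cfg (loc l i) r \<omega> out k) =
    exec (node_code (length Q) l (Q ! l) ! i) (cfg (loc l i) r \<omega> out k)"
proof -
  have "27 * l + i < 27 * length Q"
    using assms by linarith
  moreover have "(27 * l + i) div 27 = l" "(27 * l + i) mod 27 = i"
    using assms by auto
  ultimately show ?thesis
    by (simp add: step_def halted_def compile_def cfg_def loc_def del: exec.simps)
qed

text \<open>
  Unfolding \<open>exec\<close> would destroy the form \<open>cfg\<close> of configurations, on which \<open>exec_cfg\<close> acts.
\<close>

declare exec.simps [simp del]

text \<open>
  The block invariant: at the start of a block only registers 0, 1 and 2 matter, so the scratch
  registers need not be cleared between blocks.
\<close>

definition represents :: "nat \<Rightarrow> state + bool \<Rightarrow> bool stream \<times> bool stream \<Rightarrow> nat \<Rightarrow> config \<Rightarrow> bool" where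
  "represents L x \<omega> k c \<longleftrightarrow> (case x of
     Inl (l, n, v) \<Rightarrow> l < L \<and> (\<exists>r. c = cfg (loc l 0) r \<omega> [] k \<and> r 0 = 0 \<and> r 1 = n \<and> r 2 = v)
   | Inr b \<Rightarrow> \<exists>r. c = cfg (loc L 0) r \<omega> [of_bool b] k)"

lemma target_code_correct:
  assumes l: "l < length Q" and i: "i + 4 \<le> 27"
    and code: "\<And>j. j < 4 \<Longrightarrow> node_code (length Q) l (Q ! l) ! (i + j) = target_code (length Q) t ! j"
    and t: "target_ok (length Q) t" and r: "r 0 = 0"
  shows "\<exists>c. reaches (compile Q) (cfg (loc l i) r \<omega> [] k) c \<and>
    represents (length Q) (enter (r 1) t) \<omega> k c"
proof (rule exI conjI)+
  have run: "step (compile Q) (cfg (loc l i) r \<omega> out k) =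
        exec (target_code (length Q) t ! 0) (cfg (loc l i) r \<omega> out k)"
      "step (compile Q) (cfg (loc l (Suc i)) r \<omega> out k) =
        exec (target_code (length Q) t ! 1) (cfg (loc l (Suc i)) r \<omega> out k)"
      "step (compile Q) (cfg (loc l (Suc (Suc i))) r \<omega> out k) =
        exec (target_code (length Q) t ! 2) (cfg (loc l (Suc (Suc i))) r \<omega> out k)"
      "step (compile Q) (cfg (loc l (Suc (Suc (Suc i)))) r \<omega> out k) =
        exec (target_code (length Q) t ! 3) (cfg (loc l (Suc (Suc (Suc i)))) r \<omega> out k)"
    for r out
    using i code[of 0] code[of "Suc 0"] code[of "Suc (Suc 0)"] code[of "Suc (Suc (Suc 0))"]
    by (simp_all add: step_cfg[OF l] numeral_2_eq_2 numeral_3_eq_3)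
  show "reaches (compile Q) (cfg (loc l i) r \<omega> [] k)
      ((step (compile Q) ^^ Suc (Suc (Suc (Suc 0)))) (cfg (loc l i) r \<omega> [] k))"
    unfolding reaches_def by blast
  show "represents (length Q) (enter (r 1) t) \<omega> k
      ((step (compile Q) ^^ Suc (Suc (Suc (Suc 0)))) (cfg (loc l i) r \<omega> [] k))"
  proof (cases t)
    case (Out b)
    show ?thesis
      by (cases b) (auto simp add: Out run exec_cfg represents_def)
  next
    case (Goto l' u)
    show ?thesis
      using t r by (cases u) (auto simp add: Goto run exec_cfg represents_def)
  qed
qed

lemma doubling_loop_correct:
  assumes l: "l < length Q" and node: "Q ! l = Coin e a b"
  shows "r 0 = 0 \<Longrightarrow> r 5 \<le> r 2 \<Longrightarrow>
    \<exists>r'. reaches (compile Q) (cfg (loc l 6) r \<omega> [] k) (cfg (loc l 15) r' \<omega> [] k) \<and>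
      r' 0 = 0 \<and> r' 1 = r 1 \<and> r' 2 = r 2 \<and>
      (r' 6, r' 7) = (tick (r 4) ^^ (r 2 - r 5)) (r 6, r 7)"
proof (induction "r 2 - r 5" arbitrary: r)
  case 0
  then have "r 5 = r 2" by simp
  have "reaches (compile Q) (cfg (loc l 6) r \<omega> [] k) (cfg (loc l 15) r \<omega> [] k)"
    by (rule reaches_step, simp add: \<open>r 5 = r 2\<close> step_cfg[OF l] node exec_cfg reaches_refl)+
  with 0 show ?case by auto
next
  case (Suc d)
  define r1 where "r1 = (if r 6 = r 4 then r(7 := 1, 6 := 1, 5 := Suc (r 5))
    else r(6 := Suc (r 6), 5 := Suc (r 5)))"
  have neq: "r 5 \<noteq> r 2"
    using Suc.hyps(2) by auto
  have "reaches (compile Q) (cfg (loc l 6) r \<omega> [] k) (cfg (loc l 6) r1 \<omega> [] k)"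
  proof (cases "r 6 = r 4")
    case True
    have "r(6 := 0, 7 := 0, 7 := Suc 0, 6 := Suc 0, 5 := Suc (r 5)) = r1"
      by (auto simp: r1_def True)
    then show ?thesis
      by - (rule reaches_step, simp add: neq True step_cfg[OF l] node exec_cfg reaches_refl)+
  next
    case False
    then show ?thesis
      by - (rule reaches_step, simp add: neq False step_cfg[OF l] node exec_cfg r1_def reaches_refl)+
  qed
  moreover have "\<exists>r'. reaches (compile Q) (cfg (loc l 6) r1 \<omega> [] k) (cfg (loc l 15) r' \<omega> [] k) \<and>
      r' 0 = 0 \<and> r' 1 = r1 1 \<and> r' 2 = r1 2 \<and>
      (r' 6, r' 7) = (tick (r1 4) ^^ (r1 2 - r1 5)) (r1 6, r1 7)"
    using Suc.hyps(2) Suc.prems by (intro Suc.hyps(1)) (auto simp: r1_def)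
  moreover have "(tick (r1 4) ^^ (r1 2 - r1 5)) (r1 6, r1 7) =
      (tick (r 4) ^^ (r 2 - r 5)) (r 6, r 7)"
  proof -
    have "r1 2 - r1 5 = d" "r 2 - r 5 = Suc d" "r1 4 = r 4"
      using Suc.hyps(2) by (auto simp: r1_def)
    moreover have "(r1 6, r1 7) = tick (r 4) (r 6, r 7)"
      by (auto simp: r1_def)
    ultimately show ?thesis by (simp del: funpow.simps add: funpow_Suc_right)
  qed
  moreover have "r1 1 = r 1" "r1 2 = r 2"
    by (auto simp: r1_def)
  ultimately show ?case
    by (metis reaches_trans)
qed

lemma node_correct:
  assumes l: "l < length Q" and ok: "list_all (node_ok (length Q)) Q" and r: "r 0 = 0"
  shows "\<exists>c. reaches (compile Q) (cfg (loc l 0) r \<omega> [] k) c \<and>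
    (case behaviour (Q ! l) (l, r 1, r 2) of (i, f) \<Rightarrow>
      represents (length Q) (f (draw i \<omega>)) (rest i \<omega>) (Suc k) c)"
proof (cases "Q ! l")
  case (Query i a b)
  have ok': "target_ok (length Q) a" "target_ok (length Q) b"
    using ok l Query by (auto simp: list_all_length)
  have nodelen: "length (target_code L t) = Suc (Suc (Suc (Suc 0)))" for L t
    by (cases t) auto
  define r1 where "r1 = r(3 := of_bool (draw i \<omega>))"
  have "reaches (compile Q) (cfg (loc l 0) r \<omega> [] k)
      (cfg (loc l (if draw i \<omega> then Suc (Suc 0) else 6)) r1 (rest i \<omega>) [] (Suc k))"
    by (cases i; cases "draw i \<omega>";
        (rule reaches_step, simp add: r step_cfg[OF l] Query exec_cfg r1_def reaches_refl)+)
  moreover have "\<exists>c. reaches (compile Q) (cfg (loc l (Suc (Suc 0))) r1 (rest i \<omega>) [] (Suc k)) c \<and>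
      represents (length Q) (enter (r1 1) b) (rest i \<omega>) (Suc k) c"
    using ok'(2) r
    by (intro target_code_correct[OF l])
       (auto simp: Query r1_def nth_append nodelen nth_Cons')
  moreover have "\<exists>c. reaches (compile Q) (cfg (loc l 6) r1 (rest i \<omega>) [] (Suc k)) c \<and>
      represents (length Q) (enter (r1 1) a) (rest i \<omega>) (Suc k) c"
    using ok'(1) r
    by (intro target_code_correct[OF l])
       (auto simp: Query r1_def nth_append nodelen nth_Cons')
  moreover have "r1 1 = r 1" by (simp add: r1_def)
  ultimately show ?thesis
    by (cases "draw i \<omega>") (auto simp: Query intro: reaches_trans)
next
  case (Coin e a b)
  have ok': "target_ok (length Q) a" "target_ok (length Q) b"
    using ok l Coin by (auto simp: list_all_length)
  have nodelen: "length (target_code L t) = Suc (Suc (Suc (Suc 0)))" for L t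
    by (cases t) auto
  obtain w c where wc: "double (denominator e (r 1)) (r 2) = (w, c)"
    by (cases "double (denominator e (r 1)) (r 2)")
  define y where "y = draw False \<omega>"
  have entry: "\<exists>r1. reaches (compile Q) (cfg (loc l 0) r \<omega> [] k) (cfg (loc l 6) r1 \<omega> [] k) \<and>
      r1 0 = 0 \<and> r1 1 = r 1 \<and> r1 2 = r 2 \<and> r1 4 = denominator e (r 1) \<and>
      r1 5 = 0 \<and> r1 6 = r 2 \<and> r1 7 = 0"
  proof -
    define r1 where "r1 = (if e then r(4 := Suc (Suc (r 1)), 5 := 0, 7 := 0, 6 := r 2)
      else r(4 := r 1, 3 := 0, 5 := 0, 7 := 0, 6 := r 2))"
    have six: "Suc (Suc (Suc (Suc (Suc (Suc 0))))) = 6" by simp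
    have "reaches (compile Q) (cfg (loc l 0) r \<omega> [] k) (cfg (loc l 6) r1 \<omega> [] k)"
      by (cases e; (rule reaches_step, simp add: six step_cfg[OF l] Coin exec_cfg r1_def reaches_refl)+)
    then show ?thesis
      using r by (intro exI[of _ r1]) (auto simp: r1_def denominator_def)
  qed
  obtain r1 where r1: "reaches (compile Q) (cfg (loc l 0) r \<omega> [] k) (cfg (loc l 6) r1 \<omega> [] k)"
      "r1 0 = 0" "r1 1 = r 1" "r1 2 = r 2" "r1 4 = denominator e (r 1)"
      "r1 5 = 0" "r1 6 = r 2" "r1 7 = 0"
    using entry by blast
  obtain r2 where r2: "reaches (compile Q) (cfg (loc l 6) r1 \<omega> [] k) (cfg (loc l 15) r2 \<omega> [] k)"
      "r2 0 = 0" "r2 1 = r 1" "r2 6 = w" "r2 7 = c"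
    using doubling_loop_correct[OF l Coin, of r1 \<omega> k] r1 wc
    by (auto simp: double_def)
  define r3 where "r3 = r2(2 := w, 3 := of_bool y)"
  have r3: "r3 0 = 0" "r3 1 = r 1" "r3 2 = w"
    using r2 by (auto simp: r3_def)
  have start: "reaches (compile Q) (cfg (loc l 0) r \<omega> [] k) (cfg (loc l 15) r2 \<omega> [] k)"
    by (rule reaches_trans[OF r1(1) r2(1)])
  have branch: "reaches (compile Q) (cfg (loc l 15) r2 \<omega> [] k)
      (cfg (loc l (if c = of_bool y then 0 else if y then 19 else 23)) r3 (rest False \<omega>) [] (Suc k))"
    by (cases "c = of_bool y"; cases y;
       (rule reaches_step, simp add: r2 step_cfg[OF l] Coin exec_cfg r3_def reaches_refl
          y_def[symmetric] del: draw.simps rest.simps)+)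
  have "\<exists>c. reaches (compile Q) (cfg (loc l 19) r3 (rest False \<omega>) [] (Suc k)) c \<and>
      represents (length Q) (enter (r3 1) a) (rest False \<omega>) (Suc k) c"
    using ok'(1) r3
    by (intro target_code_correct[OF l])
       (auto simp: Coin nth_append nodelen nth_Cons')
  moreover have "\<exists>c. reaches (compile Q) (cfg (loc l 23) r3 (rest False \<omega>) [] (Suc k)) c \<and>
      represents (length Q) (enter (r3 1) b) (rest False \<omega>) (Suc k) c"
    using ok'(2) r3
    by (intro target_code_correct[OF l])
       (auto simp: Coin nth_append nodelen nth_Cons')
  moreover have "represents (length Q) (Inl (l, r 1, w)) (rest False \<omega>) (Suc k)
      (cfg (loc l 0) r3 (rest False \<omega>) [] (Suc k))"
    using l r3 by (auto simp: represents_def)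
  ultimately show ?thesis
    using start branch r3 unfolding Coin behaviour.simps wc prod.case y_def[symmetric]
    by (cases "c = of_bool y"; cases y; simp del: draw.simps rest.simps; blast intro: reaches_trans)
qed

text \<open>
  One transition of the automaton corresponds to one pass through a block, which makes exactly one
  call.  The number of calls is tracked up to equality for runs that have not stopped: it then bounds
  the number of machine steps from below, which is what excludes halting of the machine before the
  automaton has an output.
\<close>

lemma simulation:
  assumes ok: "list_all (node_ok (length Q)) Q"
  shows "represents (length Q) x \<omega> k c \<Longrightarrow> \<exists>c' \<omega>' k'. reaches (compile Q) c c' \<and>
    represents (length Q) (advance (transition Q) m x \<omega>) \<omega>' k' c' \<and> k' \<le> k + m \<and>
    (advance (transition Q) m x \<omega> \<in> range Inl \<longrightarrow> k' = k + m)"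
proof (induction m arbitrary: x \<omega> k c)
  case 0
  then show ?case
    by (intro exI[of _ c] exI[of _ \<omega>] exI[of _ k]) (auto simp: reaches_refl)
next
  case (Suc m)
  show ?case
  proof (cases x)
    case (Inl s)
    obtain l n v where s: "s = (l, n, v)" by (cases s)
    obtain r where l: "l < length Q" and c: "c = cfg (loc l 0) r \<omega> [] k"
      and r: "r 0 = 0" "r 1 = n" "r 2 = v"
      using Suc.prems by (auto simp: represents_def Inl s)
    define i where "i = fst (transition Q s)"
    have "\<exists>c1. reaches (compile Q) c c1 \<and>
        represents (length Q) (snd (transition Q s) (draw i \<omega>)) (rest i \<omega>) (Suc k) c1"
      using node_correct[OF l ok, of r \<omega> k] l
      by (simp add: c r[unfolded One_nat_def] i_def transition_def s case_prod_beta)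
    then obtain c1 where c1: "reaches (compile Q) c c1"
      "represents (length Q) (snd (transition Q s) (draw i \<omega>)) (rest i \<omega>) (Suc k) c1"
      by blast
    from Suc.IH[OF c1(2)] obtain c' \<omega>' k' where c': "reaches (compile Q) c1 c'"
      "represents (length Q) (advance (transition Q) (Suc m) x \<omega>) \<omega>' k' c'"
      "k' \<le> Suc k + m"
      "advance (transition Q) (Suc m) x \<omega> \<in> range Inl \<longrightarrow> k' = Suc k + m"
      unfolding Inl advance.simps i_def by blast
    show ?thesis
      using reaches_trans[OF c1(1) c'(1)] c'(2-4)
      by (intro exI[of _ c'] exI[of _ \<omega>'] exI[of _ k']) simp
  next
    case (Inr b)
    with Suc.prems show ?thesis
      by (intro exI[of _ c] exI[of _ \<omega>] exI[of _ k]) (auto simp: reaches_refl)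
  qed
qed

lemma calls_step: "calls c \<le> calls (step P c)" "calls (step P c) \<le> Suc (calls c)"
  by (cases "P ! pc c"; simp add: step_def exec.simps)+

lemma calls_run_le: "calls (run P \<omega> k) \<le> k"
  by (induction k) (auto simp: run_def init_def intro: order_trans[OF calls_step(2)])

lemma calls_run_mono: "j \<le> k \<Longrightarrow> calls (run P \<omega> j) \<le> calls (run P \<omega> k)"
  by (induction rule: dec_induct) (auto simp: run_def intro: order_trans[OF _ calls_step(1)])

lemma run_halted: "halted P (run P \<omega> j) \<Longrightarrow> j \<le> k \<Longrightarrow> run P \<omega> k = run P \<omega> j"
proof (induction k)
  case (Suc k)
  then show ?case by (cases "j = Suc k") (auto simp: run_def step_def)
qed simp

lemma halts_with_unique:
  assumes "halts_with P \<omega> ys" "halts_with P \<omega> zs"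
  shows "ys = zs"
  using assms unfolding halts_with_def by (metis nat_le_linear run_halted)

lemma represents_initial:
  "Q \<noteq> [] \<Longrightarrow> represents (length Q) (Inl (0, 0, 0)) \<omega> 0 (init \<omega>)"
  by (auto simp: represents_def cfg_def init_def loc_def)

lemma compiled_output:
  assumes ok: "list_all (node_ok (length Q)) Q" "Q \<noteq> []"
    and adv: "advance (transition Q) m (Inl (0, 0, 0)) \<omega> = Inr b"
  shows "halts_with (compile Q) \<omega> [of_bool b]" "coin_flips (compile Q) \<omega> \<le> enat m"
proof -
  obtain c k r where c: "reaches (compile Q) (init \<omega>) c" "pc c = loc (length Q) 0"
      "outqueue c = [of_bool b]" "calls c \<le> m"
    using simulation[OF ok(1) represents_initial[OF ok(2)], of \<omega> m]
    by (auto simp: adv represents_def cfg_def)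
  then obtain j where j: "run (compile Q) \<omega> j = c"
    by (auto simp: reaches_def run_def)
  have h: "halted (compile Q) (run (compile Q) \<omega> j)"
    unfolding j by (simp add: halted_def c compile_def)
  show "halts_with (compile Q) \<omega> [of_bool b]"
    unfolding halts_with_def using h j c by blast
  show "coin_flips (compile Q) \<omega> \<le> enat m"
    unfolding coin_flips_def
  proof (rule SUP_least)
    fix k
    have "calls (run (compile Q) \<omega> k) \<le> calls (run (compile Q) \<omega> j)"
      using run_halted[OF h, of k] calls_run_mono[of k j "compile Q" \<omega>] by (cases "k \<le> j") auto
    then show "enat (calls (run (compile Q) \<omega> k)) \<le> enat m"
      using c(4) j by simp
  qed
qed

lemma compiled_halts:
  assumes ok: "list_all (node_ok (length Q)) Q" "Q \<noteq> []"
    and h: "halted (compile Q) (run (compile Q) \<omega> j)"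
  shows "\<exists>b. advance (transition Q) (Suc j) (Inl (0, 0, 0)) \<omega> = Inr b"
proof (rule ccontr)
  assume "\<not> ?thesis"
  then obtain s where s: "advance (transition Q) (Suc j) (Inl (0, 0, 0)) \<omega> = Inl s"
    by (cases "advance (transition Q) (Suc j) (Inl (0, 0, 0)) \<omega>") auto
  obtain l n v where s': "s = (l, n, v)" by (cases s)
  obtain c where c: "reaches (compile Q) (init \<omega>) c" "l < length Q" "pc c = loc l 0"
      "calls c = Suc j"
    using simulation[OF ok(1) represents_initial[OF ok(2)], of \<omega> "Suc j"]
    by (auto simp: s s' represents_def cfg_def simp del: advance.simps)
  then obtain k where k: "run (compile Q) \<omega> k = c"
    by (auto simp: reaches_def run_def)
  have "Suc j \<le> k"
    using calls_run_le[of "compile Q" \<omega> k] c k by simp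
  then have "halted (compile Q) c"
    using run_halted[OF h, of k] h k by simp
  then show False
    using c by (simp add: halted_def compile_def loc_def)
qed

definition realizes :: "node list \<Rightarrow> (real \<Rightarrow> real) \<Rightarrow> bool" where
  "realizes Q \<phi> \<longleftrightarrow> Q \<noteq> [] \<and> list_all (node_ok (length Q)) Q \<and>
     (\<exists>r R. descends (transition Q) r \<and> (\<forall>s. r s \<le> R)) \<and>
     (\<forall>p\<in>{0<..<1}. chance p (transition Q) (Inl (0, 0, 0)) = \<phi> p)"

theorem realizes_imp_strongly_realizable:
  assumes Q: "realizes Q \<phi>" and range: "\<And>x. 0 < x \<Longrightarrow> x < 1 \<Longrightarrow> 0 < \<phi> x \<and> \<phi> x < 1"
  shows "strongly_realizable \<phi>"
proof -
  let ?\<delta> = "transition Q" and ?s = "Inl (0, 0, 0) :: state + bool" and ?P = "compile Q"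
  have ok: "list_all (node_ok (length Q)) Q" "Q \<noteq> []"
    and ch: "\<And>p. 0 < p \<Longrightarrow> p < 1 \<Longrightarrow> chance p ?\<delta> ?s = \<phi> p"
    using Q by (auto simp: realizes_def)
  obtain r R where r: "descends ?\<delta> r" "\<And>s. r s \<le> R"
    using Q by (auto simp: realizes_def)
  have out: "halts_with ?P \<omega> [1] \<longleftrightarrow> (\<exists>m. advance ?\<delta> m ?s \<omega> = Inr True)" for \<omega>
  proof
    assume h: "halts_with ?P \<omega> [1]"
    then obtain j b where "advance ?\<delta> (Suc j) ?s \<omega> = Inr b"
      using compiled_halts[OF ok] unfolding halts_with_def by blast
    moreover from compiled_output(1)[OF ok this] have "b = True"
      using halts_with_unique[OF h] by (cases b) auto
    ultimately show "\<exists>m. advance ?\<delta> m ?s \<omega> = Inr True" by blast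
  next
    assume "\<exists>m. advance ?\<delta> m ?s \<omega> = Inr True"
    then obtain m where "advance ?\<delta> m ?s \<omega> = Inr True" by blast
    from compiled_output(1)[OF ok this] show "halts_with ?P \<omega> [1]" by simp
  qed
  have weak: "weak_simulation ?P \<phi>"
    unfolding weak_simulation_def
  proof (intro ballI conjI)
    fix p :: real assume p: "p \<in> {0<..<1}"
    have "AE \<omega> in sources p. \<exists>m b. advance ?\<delta> m ?s \<omega> = Inr b"
      using p by (intro descending_AE_halts[OF _ _ r]) auto
    then show "AE \<omega> in sources p. halts_with ?P \<omega> [0] \<or> halts_with ?P \<omega> [1]"
    proof eventually_elim
      case (elim \<omega>)
      then obtain m b where "advance ?\<delta> m ?s \<omega> = Inr b" by blast
      from compiled_output(1)[OF ok this] show ?case by (cases b) auto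
    qed
    show "measure (sources p) {\<omega> \<in> space (sources p). halts_with ?P \<omega> [1]} = \<phi> p"
      using ch[of p] p by (simp add: out[simplified] chance_def)
  qed
  have tails: "exponential_tails ?P"
    unfolding exponential_tails_def
  proof (intro ballI)
    fix p :: real assume "p \<in> {0<..<1}"
    then have p: "0 < p" "p < 1" by auto
    interpret prob_space "sources p" by (rule prob_space_sources)
    obtain \<rho> where \<rho>: "0 < \<rho>" "\<rho> < 1"
        "\<And>m x. expected p ?\<delta> (indicator (range Inl)) m x \<le> 2 * \<rho> ^ m"
      using descending_alive[OF p r] by blast
    have "measure (sources p) {\<omega> \<in> space (sources p). enat m < coin_flips ?P \<omega>} \<le> 2 * \<rho> ^ m" for m
    proof -
      have "{\<omega> \<in> space (sources p). enat m < coin_flips ?P \<omega>} \<subseteq> {\<omega>. advance ?\<delta> m ?s \<omega> \<in> range Inl}"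
      proof
        fix \<omega> assume "\<omega> \<in> {\<omega> \<in> space (sources p). enat m < coin_flips ?P \<omega>}"
        then have "\<not> coin_flips ?P \<omega> \<le> enat m" by (simp add: not_le)
        then have "advance ?\<delta> m ?s \<omega> \<noteq> Inr b" for b
          using compiled_output(2)[OF ok] by blast
        then show "\<omega> \<in> {\<omega>. advance ?\<delta> m ?s \<omega> \<in> range Inl}"
          by (cases "advance ?\<delta> m ?s \<omega>") auto
      qed
      then have "measure (sources p) {\<omega> \<in> space (sources p). enat m < coin_flips ?P \<omega>} \<le>
          measure (sources p) {\<omega>. advance ?\<delta> m ?s \<omega> \<in> range Inl}"
        by (rule finite_measure_mono) (rule sets_advance)
      also have "\<dots> \<le> 2 * \<rho> ^ m"
        unfolding measure_advance[OF p] by (rule \<rho>)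
      finally show ?thesis .
    qed
    with \<rho> show "\<exists>K \<rho>. 0 < \<rho> \<and> \<rho> < 1 \<and> (\<forall>m. measure (sources p)
        {\<omega> \<in> space (sources p). enat m < coin_flips ?P \<omega>} \<le> K * \<rho> ^ m)"
      by blast
  qed
  show ?thesis
    unfolding strongly_realizable_def using range weak tails by auto
qed

section \<open>Acceptance probabilities of nodes\<close>

lemma tick_funpow:
  assumes "1 \<le> v" "v \<le> D" "j \<le> v"
  shows "(tick D ^^ j) (v, 0) = (if v + j \<le> D then (v + j, 0) else (v + j - D, 1))"
  using assms(3)
proof (induction j)
  case (Suc j)
  then show ?case using assms by auto
qed (use assms in simp)

lemma double_eq:
  assumes "1 \<le> v" "v \<le> D"
  shows "double D v = (if 2 * v \<le> D then (2 * v, 0) else (2 * v - D, 1))"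
  using tick_funpow[OF assms le_refl] by (simp add: double_def mult_2)

abbreviation chance_at :: "real \<Rightarrow> node list \<Rightarrow> nat \<Rightarrow> nat \<Rightarrow> real" where
  "chance_at p Q l n \<equiv> chance p (transition Q) (Inl (l, n, 1))"

abbreviation chance_target :: "real \<Rightarrow> node list \<Rightarrow> nat \<Rightarrow> target \<Rightarrow> real" where
  "chance_target p Q n t \<equiv> chance p (transition Q) (enter n t)"

lemma chance_Query:
  assumes p: "0 < p" "p < 1" and l: "l < length Q" "Q ! l = Query i a b"
  shows "chance p (transition Q) (Inl (l, n, v)) =
    bias p i * chance_target p Q n b + (1 - bias p i) * chance_target p Q n a"
  by (subst chance_Inl[OF p]) (simp add: transition_def l)

text \<open>
  Let \<open>g v\<close> be the difference between the true and the claimed probability for the bias \<open>v / D\<close>.  A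
  flip ends the toss with probability 1/2, and otherwise doubles the bias modulo 1; the claimed
  probability obeys the same equation, so \<open>g v\<close> is half of another value of \<open>g\<close>.  As \<open>g\<close> is bounded,
  it vanishes.
\<close>

lemma chance_Coin:
  assumes p: "0 < p" "p < 1" and l: "l < length Q" "Q ! l = Coin e a b"
    and D: "D = denominator e n" "1 \<le> D"
  shows "chance_at p Q l n =
    (1 - 1 / real D) * chance_target p Q n a + 1 / real D * chance_target p Q n b"
proof -
  define A where "A = chance_target p Q n a"
  define B where "B = chance_target p Q n b"
  define f where "f v = chance p (transition Q) (Inl (l, n, v))" for v
  define g where "g v = f v - ((1 - real v / real D) * A + real v / real D * B)" for v
  have AB: "0 \<le> A" "A \<le> 1" "0 \<le> B" "B \<le> 1"
    by (auto simp: A_def B_def chance_bounds)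
  \<comment> \<open>the flip that agrees with the digit of \<open>v / D\<close> leaves the doubled bias \<open>w / D\<close>\<close>
  have contr: "\<exists>w. 1 \<le> w \<and> w \<le> D \<and> g v = g w / 2" if v: "1 \<le> v" "v \<le> D" for v
  proof (cases "2 * v \<le> D")
    case True
    have "f v = 1/2 * A + 1/2 * f (2 * v)"
      unfolding f_def A_def
      by (subst chance_Inl[OF p])
         (use True in \<open>simp add: transition_def l bias_def D(1)[symmetric] double_eq[OF v] f_def\<close>)
    then have "g v = g (2 * v) / 2"
      using D(2) by (simp add: g_def field_simps)
    then show ?thesis using True v by (intro exI[of _ "2 * v"]) auto
  next
    case False
    have "f v = 1/2 * f (2 * v - D) + 1/2 * B"
      unfolding f_def B_def
      by (subst chance_Inl[OF p])
         (use False in \<open>simp add: transition_def l bias_def D(1)[symmetric] double_eq[OF v] f_def\<close>)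
    then have "g v = g (2 * v - D) / 2"
      using D(2) False by (simp add: g_def field_simps of_nat_diff)
    then show ?thesis using False v by (intro exI[of _ "2 * v - D"]) auto
  qed
  have small: "\<bar>g v\<bar> \<le> 2 / 2 ^ k" if "1 \<le> v" "v \<le> D" for v k
    using that
  proof (induction k arbitrary: v)
    case 0
    have "0 \<le> (1 - real v / real D) * A" "0 \<le> real v / real D * B"
      using 0 AB by (auto intro!: mult_nonneg_nonneg)
    moreover have "(1 - real v / real D) * A \<le> (1 - real v / real D) * 1"
        "real v / real D * B \<le> real v / real D * 1"
      using 0 AB by (intro mult_left_mono; simp)+
    moreover have "0 \<le> f v" "f v \<le> 1"
      by (simp_all add: f_def chance_bounds)
    ultimately show ?case by (simp add: g_def abs_le_iff)
  next
    case (Suc k)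
    from contr[OF Suc.prems] obtain w where "1 \<le> w" "w \<le> D" "g v = g w / 2" by blast
    with Suc.IH[of w] show ?case by simp
  qed
  have "(\<lambda>k. 2 / 2 ^ k :: real) \<longlonglongrightarrow> 0"
    by (rule LIMSEQ_divide_realpow_zero) simp
  then have "\<bar>g 1\<bar> \<le> 0"
    using small[of 1] D(2) by (intro LIMSEQ_le_const[of "\<lambda>k. 2 / 2 ^ k"]) auto
  then show ?thesis
    by (simp add: g_def f_def A_def B_def)
qed

section \<open>Ranks of nodes\<close>

text \<open>
  For the descent condition a query needs one edge to an output or to a smaller rank.  A coin needs
  this of both edges, since the digit of its bias decides which of them the next flip can take.
\<close>

fun lower :: "(nat \<Rightarrow> nat) \<Rightarrow> nat \<Rightarrow> target \<Rightarrow> bool" where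
  "lower r l (Out b) = True"
| "lower r l (Goto l' u) = (r l' < r l)"

fun node_lower :: "(nat \<Rightarrow> nat) \<Rightarrow> nat \<Rightarrow> node \<Rightarrow> bool" where
  "node_lower r l (Query i a b) = (lower r l a \<or> lower r l b)"
| "node_lower r l (Coin e a b) = (lower r l a \<and> lower r l b)"

lemma snd_tick: "snd ((tick D ^^ j) (v, 0)) \<in> {0, 1}"
proof (induction j)
  case (Suc j)
  then show ?case
    by (cases "(tick D ^^ j) (v, 0)") auto
qed simp

lemma descends_transition:
  assumes "\<And>l. l < length Q \<Longrightarrow> node_lower r l (Q ! l)"
  shows "descends (transition Q) (\<lambda>s. r (fst s))"
  unfolding descends_def
proof
  fix s :: state
  obtain l n v where s: "s = (l, n, v)" by (cases s)
  have lower: "case enter n t of Inl t' \<Rightarrow> r (fst t') < r (fst s) | Inr _ \<Rightarrow> True"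
    if "lower r l t" for t
    using that by (cases t) (auto simp: s)
  show "\<exists>b. case snd (transition Q s) b of Inl t \<Rightarrow> r (fst t) < r (fst s) | Inr _ \<Rightarrow> True"
  proof (cases "l < length Q")
    case True
    show ?thesis
    proof (cases "Q ! l")
      case (Query i a b)
      with assms[OF True] have "lower r l a \<or> lower r l b" by simp
      then show ?thesis
      proof
        assume "lower r l a"
        from lower[OF this] show ?thesis
          by (intro exI[of _ False]) (simp add: transition_def s True Query)
      next
        assume "lower r l b"
        from lower[OF this] show ?thesis
          by (intro exI[of _ True]) (simp add: transition_def s True Query)
      qed
    next
      case (Coin e a b)
      obtain w c where wc: "double (denominator e n) v = (w, c)"
        by (cases "double (denominator e n) v")
      then have "c = 0 \<or> c = 1"
        using snd_tick[of v "denominator e n" v] by (simp add: double_def)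
      moreover have "lower r l a" "lower r l b"
        using assms[OF True] Coin by auto
      ultimately show ?thesis
        using lower[of a] lower[of b]
        by (intro exI[of _ "c = 0"]) (auto simp: transition_def s True Coin wc)
    qed
  qed (simp add: transition_def s)
qed

text \<open>
  The list \<open>rs\<close> gives the ranks of the nodes; all conditions on a concrete program are then decided by
  computation.  In the programs below a query with an edge to an output has rank 0, a query without
  one lies above a node that it leads or restarts to, and a coin lies above the queries of its
  process.
\<close>

definition checked :: "nat list \<Rightarrow> node list \<Rightarrow> bool" where
  "checked rs Q \<longleftrightarrow> Q \<noteq> [] \<and> length rs = length Q \<and> list_all (node_ok (length Q)) Q \<and>
     list_all (\<lambda>l. node_lower ((!) rs) l (Q ! l)) [0..<length Q]"

lemma realizesI:
  assumes check: "checked rs Q"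
    and "\<And>p. 0 < p \<Longrightarrow> p < 1 \<Longrightarrow> chance p (transition Q) (Inl (0, 0, 0)) = \<phi> p"
  shows "realizes Q \<phi>"
proof -
  define r where "r l = (if l < length Q then rs ! l else 0)" for l
  have len: "length rs = length Q"
    using check by (simp add: checked_def)
  have "lower r l t" if "lower ((!) rs) l t" "target_ok (length Q) t" "l < length Q" for l t
    using that by (cases t) (auto simp: r_def)
  then have "node_lower r l u" if "node_lower ((!) rs) l u" "node_ok (length Q) u" "l < length Q" for l u
    using that by (cases u) auto
  then have "descends (transition Q) (\<lambda>s. r (fst s))"
    using check by (intro descends_transition) (auto simp: checked_def list_all_length)
  moreover have "r l \<le> sum_list rs" for l
    using len by (auto simp: r_def intro: member_le_sum_list)
  ultimately show ?thesis
    using assms unfolding realizes_def checked_def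
    by (intro conjI ballI exI[of _ "\<lambda>s. r (fst s)"] exI[of _ "sum_list rs"]) auto
qed

section \<open>Exchanging the two faces of the unknown coin\<close>

fun mirror :: "node \<Rightarrow> node" where
  "mirror (Query i a b) = (if i then Query i b a else Query i a b)"
| "mirror (Coin e a b) = Coin e a b"

lemma transition_mirror:
  "transition (map mirror Q) s =
     (fst (transition Q s), \<lambda>y. snd (transition Q s) (if fst (transition Q s) then \<not> y else y))"
proof -
  obtain l n v where "s = (l, n, v)" by (cases s)
  then show ?thesis
    by (cases "Q ! l") (auto simp: transition_def)
qed

lemma expected_mirror:
  "expected p (transition (map mirror Q)) f m x = expected (1 - p) (transition Q) f m x"
proof (induction m arbitrary: x)
  case (Suc m)
  then show ?case
    by (cases x) (auto simp: transition_mirror bias_def)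
qed simp

lemma realizes_mirror:
  assumes "realizes Q \<phi>"
  shows "realizes (map mirror Q) (\<lambda>x. \<phi> (1 - x))"
proof -
  obtain r R where r: "descends (transition Q) r" "\<And>s. r s \<le> R"
    using assms by (auto simp: realizes_def)
  have "chance p (transition (map mirror Q)) (Inl (0, 0, 0)) = \<phi> (1 - p)"
    if p: "0 < p" "p < 1" for p
  proof -
    have "chance p (transition (map mirror Q)) (Inl (0, 0, 0)) =
        chance (1 - p) (transition Q) (Inl (0, 0, 0))"
      using expected_tendsto_chance[of p "transition (map mirror Q)" "Inl (0, 0, 0)"]
        expected_tendsto_chance[of "1 - p" "transition Q" "Inl (0, 0, 0)"] p
      by (auto simp: expected_mirror intro: LIMSEQ_unique)
    then show ?thesis
      using assms p by (simp add: realizes_def)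
  qed
  moreover have "descends (transition (map mirror Q)) r"
    unfolding descends_def
  proof
    fix s
    obtain b where "case snd (transition Q s) b of Inl t \<Rightarrow> r t < r s | Inr _ \<Rightarrow> True"
      using r(1) unfolding descends_def by blast
    then show "\<exists>b. case snd (transition (map mirror Q) s) b of Inl t \<Rightarrow> r t < r s | Inr _ \<Rightarrow> True"
      by (intro exI[of _ "if fst (transition Q s) then \<not> b else b"]) (simp add: transition_mirror)
  qed
  moreover have "node_ok L (mirror u) \<longleftrightarrow> node_ok L u" for L u
    by (cases u) auto
  ultimately show ?thesis
    using assms r(2) by (auto simp: realizes_def list.pred_map comp_def)
qed

section \<open>The level process\<close>

text \<open>
  A linear recurrence \<open>w n = d n + a n * w (n + 1)\<close> is Horner's scheme for the power-like series with
  coefficients \<open>d\<close>.  Its bounded solution is unique because the weight \<open>A n\<close> of the remainder tends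
  to 0.
\<close>

lemma horner_sums:
  fixes w :: "nat \<Rightarrow> real"
  assumes rec: "\<And>n. w n = d n + a n * w (Suc n)"
    and bound: "\<And>n. \<bar>w n\<bar> \<le> K"
    and A: "A 0 = 1" "\<And>n. A (Suc n) = A n * a n" "A \<longlonglongrightarrow> 0"
  shows "(\<lambda>n. A n * d n) sums w 0"
proof -
  have part: "(\<Sum>n<N. A n * d n) = w 0 - A N * w N" for N
  proof (induction N)
    case (Suc N)
    then show ?case using rec[of N] by (simp add: A algebra_simps)
  qed (simp add: A)
  have "(\<lambda>N. A N * w N) \<longlonglongrightarrow> 0"
  proof (rule Lim_null_comparison)
    show "\<forall>\<^sub>F N in sequentially. norm (A N * w N) \<le> \<bar>A N\<bar> * K"
      using bound by (auto simp: abs_mult mult_left_mono)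
    show "(\<lambda>N. \<bar>A N\<bar> * K) \<longlonglongrightarrow> 0"
      using tendsto_mult_left_zero[OF tendsto_rabs_zero[OF A(3)]] by simp
  qed
  then have "(\<lambda>N. w 0 - A N * w N) \<longlonglongrightarrow> w 0 - 0"
    by (intro tendsto_intros)
  then show ?thesis by (simp add: sums_def part)
qed

text \<open>
  If level \<open>n\<close> is left towards \<open>n + 1\<close> with probability \<open>a n\<close> and otherwise yields \<open>\<tau> n\<close>, then
  subtracting the yield of the preceding level turns the recurrence into Horner's scheme with the
  differences of \<open>\<tau>\<close> as coefficients.  This is the Abel summation that produces negative coefficients
  from probabilities.
\<close>

definition increment :: "(nat \<Rightarrow> real) \<Rightarrow> nat \<Rightarrow> real" where
  "increment \<tau> n = \<tau> n - (if n = 0 then 0 else \<tau> (n - 1))"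

lemma chain_sums:
  fixes u \<tau> a A :: "nat \<Rightarrow> real"
  assumes rec: "\<And>n. u n = \<tau> n + a n * (u (Suc n) - \<tau> n)"
    and u: "\<And>n. 0 \<le> u n \<and> u n \<le> 1" and \<tau>: "\<And>n. 0 \<le> \<tau> n \<and> \<tau> n \<le> 1"
    and A: "A 0 = 1" "\<And>n. A (Suc n) = A n * a n" "A \<longlonglongrightarrow> 0"
  shows "(\<lambda>n. A n * increment \<tau> n) sums u 0"
proof -
  \<comment> \<open>the yield of the preceding level, which \<open>u n\<close> replaces once level \<open>n\<close> is reached\<close>
  define w where "w n = u n - (if n = 0 then 0 else \<tau> (n - 1))" for n
  have "(\<lambda>n. A n * increment \<tau> n) sums w 0"
  proof (rule horner_sums[OF _ _ A])
    show "w n = increment \<tau> n + a n * w (Suc n)" for n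
      using rec[of n] by (simp add: w_def increment_def)
    show "\<bar>w n\<bar> \<le> 1" for n
      using u[of n] \<tau>[of "n - 1"] by (auto simp: w_def abs_le_iff)
  qed
  then show ?thesis by (simp add: w_def)
qed

lemma chance_level:
  assumes p: "0 < p" "p < 1"
    and l: "l < length Q" "Q ! l = Query True t (Goto l' Incr)"
    and l': "l' < length Q" "Q ! l' = Coin e t (Goto l'' Keep)"
    and T: "\<And>n. chance_target p Q n t = T"
  shows "chance p (transition Q) (Inl (l, n, v)) =
    T + p / real (denominator e (Suc n)) * (chance_at p Q l'' (Suc n) - T)"
proof -
  define D where "D = denominator e (Suc n)"
  have "1 \<le> D" by (simp add: D_def denominator_def)
  then have "chance_at p Q l' (Suc n) = (1 - 1 / real D) * T + 1 / real D * chance_at p Q l'' (Suc n)"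
    using chance_Coin[OF p l' D_def] by (simp add: T)
  then have "chance p (transition Q) (Inl (l, n, v)) =
      p * ((1 - 1 / real D) * T + 1 / real D * chance_at p Q l'' (Suc n)) + (1 - p) * T"
    by (simp add: chance_Query[OF p l] T bias_def)
  then show ?thesis
    by (simp add: D_def algebra_simps)
qed

text \<open>
  The level process, with its nodes at the labels \<open>k, \<dots>, k + 8\<close>.  A stop leads to \<open>t0\<close> at level 0, and
  at level \<open>n > 0\<close> to the target selected by the residue of \<open>n\<close> modulo 4.  At level 0 the coin would
  have bias 1 and is left out.  If \<open>g\<close> holds, the counter lags one behind the level, so that at level
  \<open>n > 0\<close> the denominators are \<open>n + 2\<close> for odd \<open>n\<close> and \<open>n\<close> for even \<open>n\<close>: the order
  \<open>1, 3, 2, 5, 4, \<dots>\<close>.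
\<close>

definition cycle :: "bool \<Rightarrow> nat \<Rightarrow> target \<Rightarrow> target \<Rightarrow> target \<Rightarrow> target \<Rightarrow> target \<Rightarrow> node list" where
  "cycle g k t0 t1 t2 t3 t4 =
    [Query True t0 (Goto (k + 1) (if g then Keep else Incr)),
     Query True t1 (Goto (k + 2) Incr), Coin g t1 (Goto (k + 3) Keep),
     Query True t2 (Goto (k + 4) Incr), Coin False t2 (Goto (k + 5) Keep),
     Query True t3 (Goto (k + 6) Incr), Coin g t3 (Goto (k + 7) Keep),
     Query True t4 (Goto (k + 8) Incr), Coin False t4 (Goto (k + 1) Keep)]"

definition periodic :: "'a \<Rightarrow> 'a \<Rightarrow> 'a \<Rightarrow> 'a \<Rightarrow> 'a \<Rightarrow> nat \<Rightarrow> 'a" where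
  "periodic c0 c1 c2 c3 c4 n = (if n = 0 then c0 else if n mod 4 = 1 then c1
     else if n mod 4 = 2 then c2 else if n mod 4 = 3 then c3 else c4)"

text \<open>
  The probability of reaching level \<open>n\<close>.  In the permuted order the factors of an even level \<open>2 * k\<close>
  are those of \<open>(2 * k + 1)!\<close> without \<open>2 * k\<close>.
\<close>

definition weight :: "bool \<Rightarrow> real \<Rightarrow> nat \<Rightarrow> real" where
  "weight g x n = (if g \<and> even n \<and> n \<noteq> 0 then x ^ n * real n / fact (Suc n) else x ^ n / fact n)"

lemma weight_tendsto_0:
  assumes p: "0 < p" "p < 1"
  shows "weight g p \<longlonglongrightarrow> 0"
proof -
  have "\<bar>weight g p n\<bar> \<le> p ^ n" for n
  proof -
    have "real n \<le> fact (Suc n)"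
      using fact_ge_self[of "Suc n"] of_nat_mono[of n "fact (Suc n)"] by (simp del: fact_Suc)
    then have "real n / fact (Suc n) \<le> 1" by (simp del: fact_Suc)
    moreover have "1 / fact n \<le> (1::real)" by (simp add: fact_ge_1)
    ultimately have "p ^ n * (real n / fact (Suc n)) \<le> p ^ n * 1" "p ^ n * (1 / fact n) \<le> p ^ n * 1"
      using p by (intro mult_left_mono; simp)+
    then show ?thesis
      using p by (simp add: weight_def abs_mult del: fact_Suc)
  qed
  then show ?thesis
    using p by (intro Lim_null_comparison[OF _ LIMSEQ_power_zero[of p]]) auto
qed

text \<open>
  The targets enter only through their chances \<open>T0, \<dots>, T4\<close>, which must not depend on the counter.
  For a restart the chance is the unknown quantity itself, and the series below becomes a linear
  equation for it.
\<close>

lemma cycle_sums: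
  assumes p: "0 < p" "p < 1"
    and Q: "take 9 (drop k Q) = cycle g k t0 t1 t2 t3 t4" "k + 9 \<le> length Q"
    and T: "\<And>n. chance_target p Q n t0 = T0" "\<And>n. chance_target p Q n t1 = T1"
      "\<And>n. chance_target p Q n t2 = T2" "\<And>n. chance_target p Q n t3 = T3"
      "\<And>n. chance_target p Q n t4 = T4"
  shows "(\<lambda>n. weight g p n * increment (periodic T0 T1 T2 T3 T4) n) sums
    chance p (transition Q) (Inl (k, 0, v))"
proof -
  define \<tau> where "\<tau> = periodic T0 T1 T2 T3 T4"
  define u where "u n = chance_at p Q (periodic k (k + 1) (k + 3) (k + 5) (k + 7) n)
      (if g then n - 1 else n)" for n
  define D where "D n = (if n = 0 then 1 else if g \<and> odd n then n + 2 else if g then n else n + 1)" for n :: nat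
  have nth: "Q ! (k + i) = cycle g k t0 t1 t2 t3 t4 ! i" if "i < 9" for i
    using that Q(2) by (simp add: Q(1)[symmetric])
  have node:
    "Q ! k = Query True t0 (Goto (k + 1) (if g then Keep else Incr))"
    "Q ! (k + 1) = Query True t1 (Goto (k + 2) Incr)" "Q ! (k + 2) = Coin g t1 (Goto (k + 3) Keep)"
    "Q ! (k + 3) = Query True t2 (Goto (k + 4) Incr)" "Q ! (k + 4) = Coin False t2 (Goto (k + 5) Keep)"
    "Q ! (k + 5) = Query True t3 (Goto (k + 6) Incr)" "Q ! (k + 6) = Coin g t3 (Goto (k + 7) Keep)"
    "Q ! (k + 7) = Query True t4 (Goto (k + 8) Incr)" "Q ! (k + 8) = Coin False t4 (Goto (k + 1) Keep)"
    using nth[of 0] nth[of 1] nth[of 2] nth[of 3] nth[of 4] nth[of 5] nth[of 6] nth[of 7] nth[of 8]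
    by (simp_all add: cycle_def)
  have len: "k < length Q" "k + i < length Q" if "i < 9" for i
    using that Q(2) by auto
  have level: "u n = \<tau> n + p / real (D n) * (u (Suc n) - \<tau> n)" for n
  proof (cases "n = 0")
    case True
    show ?thesis
      using chance_Query[OF p _ node(1), of 0 1] Q(2) T(1)
      by (simp add: True u_def \<tau>_def D_def periodic_def bias_def algebra_simps)
  next
    case False
    have "n mod 4 < 4" by simp
    then consider "n mod 4 = 1" | "n mod 4 = 2" | "n mod 4 = 3" | "n mod 4 = 0"
      by linarith
    then show ?thesis
    proof cases
      case 1
      then have "odd n" "Suc n mod 4 = 2" by presburger+
      then show ?thesis
        using chance_level[OF p _ node(2) _ node(3) T(2), of "if g then n - 1 else n" 1] Q(2) False 1
        by (cases g) (auto simp: u_def \<tau>_def D_def periodic_def denominator_def)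
    next
      case 2
      then have "even n" "Suc n mod 4 = 3" by presburger+
      then show ?thesis
        using chance_level[OF p _ node(4) _ node(5) T(3), of "if g then n - 1 else n" 1] Q(2) False 2
        by (cases g) (auto simp: u_def \<tau>_def D_def periodic_def denominator_def)
    next
      case 3
      then have "odd n" "Suc n mod 4 = 0" by presburger+
      then show ?thesis
        using chance_level[OF p _ node(6) _ node(7) T(4), of "if g then n - 1 else n" 1] Q(2) False 3
        by (cases g) (auto simp: u_def \<tau>_def D_def periodic_def denominator_def)
    next
      case 4
      then have "even n" "Suc n mod 4 = 1" by presburger+
      then show ?thesis
        using chance_level[OF p _ node(8) _ node(9) T(5), of "if g then n - 1 else n" 1] Q(2) False 4
        by (cases g) (auto simp: u_def \<tau>_def D_def periodic_def denominator_def)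
    qed
  qed
  have "(\<lambda>n. weight g p n * increment \<tau> n) sums u 0"
  proof (rule chain_sums[where u = u and a = "\<lambda>n. p / real (D n)", OF level])
    show "0 \<le> u n \<and> u n \<le> 1" for n
      by (simp add: u_def chance_bounds)
    have "0 \<le> T0 \<and> T0 \<le> 1" "0 \<le> T1 \<and> T1 \<le> 1" "0 \<le> T2 \<and> T2 \<le> 1" "0 \<le> T3 \<and> T3 \<le> 1"
        "0 \<le> T4 \<and> T4 \<le> 1"
      unfolding T[of 0, symmetric] by (simp_all add: chance_bounds)
    then show "0 \<le> \<tau> n \<and> \<tau> n \<le> 1" for n
      by (simp add: \<tau>_def periodic_def)
    show "weight g p 0 = 1"
      by (simp add: weight_def)
    show "weight g p (Suc n) = weight g p n * (p / real (D n))" for n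
    proof (cases "n = 0")
      case False
      then show ?thesis
        by (cases "even n") (auto simp: weight_def D_def divide_simps)
    qed (simp add: weight_def D_def)
    show "weight g p \<longlonglongrightarrow> 0"
      by (rule weight_tendsto_0[OF p])
  qed
  moreover have "u 0 = chance p (transition Q) (Inl (k, 0, v))"
    using chance_Query[OF p _ node(1), of 0] Q(2) by (simp add: u_def periodic_def)
  ultimately show ?thesis unfolding \<tau>_def by simp
qed

section \<open>Power series of the periodic stopping rules\<close>

lemma cos_coeff_mod4:
  "cos_coeff n = (if n mod 4 = 0 then 1 else if n mod 4 = 2 then - 1 else 0) / fact n"
proof -
  define q j where "q = n div 4" and "j = n mod 4"
  have "j < 4" by (simp add: j_def)
  then have "j = 0 \<or> j = 1 \<or> j = 2 \<or> j = 3" by linarith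
  moreover have "even n \<longleftrightarrow> even j" "n div 2 = 2 * q + j div 2"
    unfolding q_def j_def by presburger+
  ultimately show ?thesis
    unfolding cos_coeff_def j_def[symmetric] by (elim disjE) simp_all
qed

lemma sin_coeff_mod4:
  "sin_coeff n = (if n mod 4 = 1 then 1 else if n mod 4 = 3 then - 1 else 0) / fact n"
proof -
  define q j where "q = n div 4" and "j = n mod 4"
  have "j < 4" by (simp add: j_def)
  then have "j = 0 \<or> j = 1 \<or> j = 2 \<or> j = 3" by linarith
  moreover have "even n \<longleftrightarrow> even j" "odd n \<Longrightarrow> (n - Suc 0) div 2 = 2 * q + j div 2"
    unfolding q_def j_def by presburger+
  ultimately show ?thesis
    unfolding sin_coeff_def j_def[symmetric] by (elim disjE) simp_all
qed

lemma periodic_exp_sums: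
  "(\<lambda>n. weight False x n * increment (periodic 1 0 1 0 1) n) sums exp (- x)"
proof -
  have "weight False x n * increment (periodic 1 0 1 0 1) n = (- x) ^ n /\<^sub>R fact n" for n
  proof -
    have "n mod 4 < 4" by simp
    then have "n mod 4 = 0 \<or> n mod 4 = 1 \<or> n mod 4 = 2 \<or> n mod 4 = 3" by linarith
    moreover have "n mod 4 = 0 \<Longrightarrow> even n" "n mod 4 = 1 \<Longrightarrow> odd n"
        "n mod 4 = 2 \<Longrightarrow> even n" "n mod 4 = 3 \<Longrightarrow> odd n"
      by presburger+
    ultimately show ?thesis
      by (cases n)
         (auto simp: weight_def increment_def periodic_def mod_Suc divide_simps split: if_splits)
  qed
  then show ?thesis
    using exp_converges[of "- x"] by simp
qed

lemma periodic_cos_sums: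
  "(\<lambda>n. weight False x n * increment (periodic a a b b a) n) sums (b + (a - b) * cos x)"
proof -
  have "weight False x n * increment (periodic a a b b a) n =
      (if n = 0 then b else 0) + (a - b) * (cos_coeff n *\<^sub>R x ^ n)" for n
    by (cases n) (auto simp: weight_def increment_def periodic_def mod_Suc cos_coeff_mod4 field_simps)
  then show ?thesis
    using sums_add[OF sums_single[of 0 "\<lambda>_. b"] sums_mult[OF cos_converges[of x], of "a - b"]] by simp
qed

lemma periodic_sin_sums:
  "(\<lambda>n. weight False x n * increment (periodic 0 1 1 0 0) n) sums sin x"
proof -
  have "weight False x n * increment (periodic 0 1 1 0 0) n = sin_coeff n *\<^sub>R x ^ n" for n
    by (cases n) (auto simp: weight_def increment_def periodic_def mod_Suc sin_coeff_mod4)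
  then show ?thesis
    using sin_converges[of x] by simp
qed

text \<open>
  The values at the levels 1, 2, 3, 4 are \<open>0, z, z, 0\<close>, so that a round restarts at the levels
  congruent to 2 and 3, with total probability \<open>1 - cos x\<close>, and level 0, with probability \<open>1 - x\<close>, is
  left for the yield \<open>s\<close>.
\<close>

lemma periodic_sec_sums:
  "(\<lambda>n. weight False x n * increment (periodic s 0 z z 0) n) sums ((1 - x) * s + z * (1 - cos x))"
proof -
  have eq: "weight False x n * increment (periodic s 0 z z 0) n =
      (if n = 0 then s else 0) + (if n = 1 then - x * s else 0) +
      z * ((if n = 0 then 1 else 0) - cos_coeff n *\<^sub>R x ^ n)" for n
    by (cases n) (auto simp: weight_def increment_def periodic_def mod_Suc cos_coeff_mod4)
  have "(\<lambda>n. (if n = 0 then s else 0) + (if n = 1 then - x * s else 0) +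
      z * ((if n = 0 then 1 else 0) - cos_coeff n *\<^sub>R x ^ n)) sums (s + - x * s + z * (1 - cos x))"
    by (intro sums_add sums_mult sums_diff cos_converges sums_single)
  then have "(\<lambda>n. weight False x n * increment (periodic s 0 z z 0) n) sums
      (s + - x * s + z * (1 - cos x))"
    by (simp only: eq)
  then show ?thesis
    by (simp add: algebra_simps)
qed

text \<open>
  Restarting at the levels congruent to 0 and 1 leaves probability \<open>sin x / x - cos x\<close> for the yield 0:
  the even weights are \<open>x ^ n / n! - x ^ n / (n + 1)!\<close>, and the odd weights have coefficient 0.
\<close>

lemma periodic_lagged_sums:
  assumes "x \<noteq> 0"
  shows "(\<lambda>n. weight True x n * increment (periodic z z 0 0 z) n) sums (z + z * (cos x - sin x / x))"
proof -
  have "(\<lambda>n. sin_coeff (Suc n) *\<^sub>R x ^ Suc n) sums sin x"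
    using sin_converges[of x] by (subst sums_Suc_iff) (simp add: sin_coeff_def)
  then have "(\<lambda>n. sin_coeff (Suc n) *\<^sub>R x ^ Suc n / x) sums (sin x / x)"
    by (rule sums_divide)
  then have "(\<lambda>n. (if n = 0 then z else 0) + z * (cos_coeff n *\<^sub>R x ^ n - sin_coeff (Suc n) *\<^sub>R x ^ Suc n / x))
      sums (z + z * (cos x - sin x / x))"
    by (intro sums_add sums_mult sums_diff cos_converges sums_single)
  moreover have "weight True x n * increment (periodic z z 0 0 z) n =
      (if n = 0 then z else 0) + z * (cos_coeff n *\<^sub>R x ^ n - sin_coeff (Suc n) *\<^sub>R x ^ Suc n / x)" for n
  proof -
    have "n mod 4 < 4" by simp
    then have "n mod 4 = 0 \<or> n mod 4 = 1 \<or> n mod 4 = 2 \<or> n mod 4 = 3" by linarith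
    moreover have "n mod 4 = 0 \<Longrightarrow> even n" "n mod 4 = 2 \<Longrightarrow> even n"
      by presburger+
    ultimately show ?thesis
      using assms
      by (cases n) (auto simp: weight_def increment_def periodic_def mod_Suc cos_coeff_mod4
          sin_coeff_mod4 divide_simps split: if_splits; simp add: algebra_simps)+
  qed
  ultimately show ?thesis by simp
qed

section \<open>Programs with periodic stopping rules\<close>

definition exp_prog :: "node list" where
  "exp_prog = cycle False 0 (Out True) (Out False) (Out True) (Out False) (Out True)"

definition cos_prog :: "node list" where
  "cos_prog = cycle False 0 (Out True) (Out True) (Out False) (Out False) (Out True)"

definition sec_prog :: "node list" where
  "sec_prog = cycle False 0 (Out True) (Out False) (Goto 0 Reset) (Goto 0 Reset) (Out False)"

text \<open>
  Where \<open>sec_prog\<close> accepts, a run of the sine flowchart at label 9 follows; its output is independent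
  of the past, so the probabilities multiply.
\<close>

definition tan_prog :: "node list" where
  "tan_prog = cycle False 0 (Goto 9 Reset) (Out False) (Goto 0 Reset) (Goto 0 Reset) (Out False) @
     cycle False 9 (Out False) (Out True) (Out True) (Out False) (Out False)"

text \<open>
  Label 0 selects one of two level processes, and all stops that do not decide return to it.
\<close>

definition cot_prog :: "node list" where
  "cot_prog = Query False (Goto 10 Reset) (Goto 1 Reset) #
     cycle False 1 (Out True) (Out True) (Goto 0 Reset) (Goto 0 Reset) (Out True) @
     cycle True 10 (Goto 0 Reset) (Goto 0 Reset) (Out False) (Out False) (Goto 0 Reset)"

lemma realizes_exp: "realizes exp_prog (\<lambda>x. exp (- x))"
proof (rule realizesI)
  show "checked [0, 0, 1, 0, 1, 0, 1, 0, 1] exp_prog"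
    by code_simp
  fix p :: real assume p: "0 < p" "p < 1"
  have block: "take 9 (drop 0 exp_prog) =
      cycle False 0 (Out True) (Out False) (Out True) (Out False) (Out True)"
    by (simp add: exp_prog_def cycle_def)
  have "(\<lambda>n. weight False p n * increment (periodic 1 0 1 0 1) n) sums
      chance p (transition exp_prog) (Inl (0, 0, 0))"
    by (rule cycle_sums[OF p block]) (simp_all add: exp_prog_def cycle_def chance_Inr[OF p])
  then show "chance p (transition exp_prog) (Inl (0, 0, 0)) = exp (- p)"
    using periodic_exp_sums sums_unique2 by blast
qed

lemma realizes_cos: "realizes cos_prog cos"
proof (rule realizesI)
  show "checked [0, 0, 1, 0, 1, 0, 1, 0, 1] cos_prog"
    by code_simp
  fix p :: real assume p: "0 < p" "p < 1"
  have block: "take 9 (drop 0 cos_prog) =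
      cycle False 0 (Out True) (Out True) (Out False) (Out False) (Out True)"
    by (simp add: cos_prog_def cycle_def)
  have "(\<lambda>n. weight False p n * increment (periodic 1 1 0 0 1) n) sums
      chance p (transition cos_prog) (Inl (0, 0, 0))"
    by (rule cycle_sums[OF p block]) (simp_all add: cos_prog_def cycle_def chance_Inr[OF p])
  from sums_unique2[OF this periodic_cos_sums]
  show "chance p (transition cos_prog) (Inl (0, 0, 0)) = cos p" by simp
qed

lemma cos_unit_pos: "0 < x \<Longrightarrow> x < 1 \<Longrightarrow> 0 < cos (x::real)"
  using pi_gt3 by (intro cos_gt_zero) auto

lemma sin_unit_pos: "0 < x \<Longrightarrow> x < 1 \<Longrightarrow> 0 < sin (x::real)"
  using pi_gt3 by (intro sin_gt_zero) auto

lemma realizes_sec: "realizes sec_prog (\<lambda>x. (1 - x) / cos x)"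
proof (rule realizesI)
  show "checked [0, 0, 2, 1, 2, 1, 2, 0, 2] sec_prog"
    by code_simp
  fix p :: real assume p: "0 < p" "p < 1"
  have block: "take 9 (drop 0 sec_prog) =
      cycle False 0 (Out True) (Out False) (Goto 0 Reset) (Goto 0 Reset) (Out False)"
    by (simp add: sec_prog_def cycle_def)
  define z where "z = chance_at p sec_prog 0 0"
  have "(\<lambda>n. weight False p n * increment (periodic 1 0 z z 0) n) sums
      chance p (transition sec_prog) (Inl (0, 0, v))" for v
    by (rule cycle_sums[OF p block]) (simp_all add: z_def sec_prog_def cycle_def chance_Inr[OF p])
  from sums_unique2[OF this periodic_sec_sums]
  have eq: "chance p (transition sec_prog) (Inl (0, 0, v)) = 1 - p + z * (1 - cos p)" for v
    by simp
  have "z * cos p = 1 - p"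
    using eq[of 1] unfolding z_def[symmetric] by (simp add: algebra_simps)
  then have "z = (1 - p) / cos p"
    using cos_unit_pos[OF p] by (simp add: field_simps)
  moreover have "chance p (transition sec_prog) (Inl (0, 0, 0)) = z"
    using eq[of 0] eq[of 1] by (simp add: z_def)
  ultimately show "chance p (transition sec_prog) (Inl (0, 0, 0)) = (1 - p) / cos p"
    by simp
qed

lemma realizes_tan: "realizes tan_prog (\<lambda>x. (1 - x) * tan x)"
proof (rule realizesI)
  show "checked [1, 0, 3, 2, 3, 2, 3, 0, 3, 0, 0, 1, 0, 1, 0, 1, 0, 1] tan_prog"
    by code_simp
  fix p :: real assume p: "0 < p" "p < 1"
  have block: "take 9 (drop 9 tan_prog) =
      cycle False 9 (Out False) (Out True) (Out True) (Out False) (Out False)"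
    by (simp add: tan_prog_def cycle_def)
  have "(\<lambda>n. weight False p n * increment (periodic 0 1 1 0 0) n) sums chance_at p tan_prog 9 0"
    by (rule cycle_sums[OF p block]) (simp_all add: tan_prog_def cycle_def chance_Inr[OF p])
  from sums_unique2[OF this periodic_sin_sums]
  have sin: "chance_at p tan_prog 9 0 = sin p" .
  have block: "take 9 (drop 0 tan_prog) =
      cycle False 0 (Goto 9 Reset) (Out False) (Goto 0 Reset) (Goto 0 Reset) (Out False)"
    by (simp add: tan_prog_def cycle_def)
  define z where "z = chance_at p tan_prog 0 0"
  have "(\<lambda>n. weight False p n * increment (periodic (sin p) 0 z z 0) n) sums
      chance p (transition tan_prog) (Inl (0, 0, v))" for v
    by (rule cycle_sums[OF p block])
       (simp_all add: z_def sin[symmetric] chance_Inr[OF p], simp_all add: tan_prog_def cycle_def)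
  from sums_unique2[OF this periodic_sec_sums]
  have eq: "chance p (transition tan_prog) (Inl (0, 0, v)) = (1 - p) * sin p + z * (1 - cos p)" for v
    by simp
  have "z * cos p = (1 - p) * sin p"
    using eq[of 1] unfolding z_def[symmetric] by (simp add: algebra_simps)
  then have "z = (1 - p) * tan p"
    using cos_unit_pos[OF p] by (simp add: tan_def field_simps)
  moreover have "chance p (transition tan_prog) (Inl (0, 0, 0)) = z"
    using eq[of 0] eq[of 1] by (simp add: z_def)
  ultimately show "chance p (transition tan_prog) (Inl (0, 0, 0)) = (1 - p) * tan p"
    by simp
qed

lemma realizes_cot: "realizes cot_prog (\<lambda>x. x / tan x)"
proof (rule realizesI)
  show "checked [1, 0, 0, 3, 2, 3, 2, 3, 0, 3, 2, 2, 3, 0, 3, 0, 3, 2, 3] cot_prog"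
    by code_simp
  fix p :: real assume p: "0 < p" "p < 1"
  define z where "z = chance_at p cot_prog 0 0"
  have block: "take 9 (drop 1 cot_prog) =
      cycle False 1 (Out True) (Out True) (Goto 0 Reset) (Goto 0 Reset) (Out True)"
    by (simp add: cot_prog_def cycle_def)
  have "(\<lambda>n. weight False p n * increment (periodic 1 1 z z 1) n) sums chance_at p cot_prog 1 0"
    by (rule cycle_sums[OF p block])
       (simp_all add: z_def chance_Inr[OF p], simp_all add: cot_prog_def cycle_def)
  from sums_unique2[OF this periodic_cos_sums]
  have heads: "chance_at p cot_prog 1 0 = z + (1 - z) * cos p" .
  have block: "take 9 (drop 10 cot_prog) =
      cycle True 10 (Goto 0 Reset) (Goto 0 Reset) (Out False) (Out False) (Goto 0 Reset)"
    by (simp add: cot_prog_def cycle_def)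
  have "(\<lambda>n. weight True p n * increment (periodic z z 0 0 z) n) sums chance_at p cot_prog 10 0"
    by (rule cycle_sums[OF p block])
       (simp_all add: z_def chance_Inr[OF p], simp_all add: cot_prog_def cycle_def)
  from sums_unique2[OF this periodic_lagged_sums] p
  have tails: "chance_at p cot_prog 10 0 = z + z * (cos p - sin p / p)" by simp
  have eq: "chance p (transition cot_prog) (Inl (0, 0, v)) =
      1/2 * chance_at p cot_prog 1 0 + 1/2 * chance_at p cot_prog 10 0" for v
    by (subst chance_Query[OF p, of 0 cot_prog False "Goto 10 Reset" "Goto 1 Reset"])
       (simp_all add: bias_def, simp_all add: cot_prog_def)
  have "2 * z = chance_at p cot_prog 1 0 + chance_at p cot_prog 10 0"
    using eq[of 1] unfolding z_def[symmetric] by linarith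
  then have "2 * z = (z + (1 - z) * cos p) + (z + z * (cos p - sin p / p))"
    unfolding heads tails .
  then have "z * sin p = p * cos p"
    using p by (simp add: field_simps)
  then have "z = p / tan p"
    using sin_unit_pos[OF p] by (simp add: tan_def field_simps)
  moreover have "chance p (transition cot_prog) (Inl (0, 0, 0)) = z"
    using eq[of 0] eq[of 1] by (simp add: z_def)
  ultimately show "chance p (transition cot_prog) (Inl (0, 0, 0)) = p / tan p"
    by simp
qed

section \<open>Programs that decide at the first tail\<close>

definition exp_tail_prog :: "node list" where
  "exp_tail_prog = [Query True (Out True) (Goto 1 Incr), Coin False (Out False) (Goto 0 Keep)]"

text \<open>
  The coin's success, of probability \<open>1 / (n + 1)\<close>, ends the run, and its failure leads on.  Hence level
  \<open>n\<close> has the weight \<open>x ^ n * (1/2) * (2/3) * \<dots> = x ^ n / n\<close>.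
\<close>

definition log_prog :: "node list" where
  "log_prog = [Query True (Out False) (Goto 1 Incr), Query True (Out True) (Goto 2 Incr),
     Coin False (Goto 1 Keep) (Out False)]"

text \<open>
  The process of \<open>log_prog\<close>, restarted until it accepts; label 1 is level 1 and label 3 stands for all
  higher levels.  Given acceptance, level \<open>n\<close> has probability \<open>(x ^ n / n) / ln (1 / (1 - x))\<close>, and the
  output tells whether the level is 1.
\<close>

definition log_ratio_prog :: "node list" where
  "log_ratio_prog = [Query True (Goto 0 Keep) (Goto 1 Incr), Query True (Out True) (Goto 2 Incr),
     Coin False (Goto 3 Keep) (Goto 0 Reset), Query True (Out False) (Goto 2 Incr)]"

lemma realizes_exp_tail: "realizes exp_tail_prog (\<lambda>x. (1 - x) * exp x)"
proof (rule realizesI)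
  show "checked [0, 1] exp_tail_prog"
    by code_simp
  fix p :: real assume p: "0 < p" "p < 1"
  define u where "u n = chance_at p exp_tail_prog 0 n" for n
  have query: "chance p (transition exp_tail_prog) (Inl (0, n, v)) =
      p * chance_at p exp_tail_prog 1 (Suc n) + (1 - p)" for n v
    by (subst chance_Query[OF p, of 0 _ True "Out True" "Goto 1 Incr"])
       (simp_all add: bias_def chance_Inr[OF p], simp_all add: exp_tail_prog_def)
  have coin: "chance_at p exp_tail_prog 1 (Suc n) = 1 / real (Suc n) * u (Suc n)" for n
    by (subst chance_Coin[OF p, of 1 _ False "Out False" "Goto 0 Keep" "Suc n"])
       (simp_all add: u_def chance_Inr[OF p] denominator_def, simp_all add: exp_tail_prog_def)
  have "(\<lambda>n. weight False p n * (1 - p)) sums u 0"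
  proof (rule horner_sums[where a = "\<lambda>n. p / real (Suc n)" and K = 1])
    show "u n = (1 - p) + p / real (Suc n) * u (Suc n)" for n
      using query[of n 1] coin[of n] by (simp add: u_def)
    show "\<bar>u n\<bar> \<le> 1" for n
      by (simp add: u_def chance_bounds)
    show "weight False p (Suc n) = weight False p n * (p / real (Suc n))" for n
      by (simp add: weight_def divide_simps)
  qed (simp_all add: weight_tendsto_0[OF p], simp add: weight_def)
  moreover have "(\<lambda>n. weight False p n * (1 - p)) sums (exp p * (1 - p))"
    using sums_mult2[OF exp_converges[of p], of "1 - p"] by (simp add: weight_def divide_inverse mult.commute)
  ultimately have "u 0 = exp p * (1 - p)"
    by (rule sums_unique2)
  then show "chance p (transition exp_tail_prog) (Inl (0, 0, 0)) = (1 - p) * exp p"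
    using query[of 0 0] query[of 0 1] by (simp add: u_def mult.commute)
qed

lemma log_sums:
  fixes x :: real
  assumes x: "0 < x" "x < 1"
  shows "(\<lambda>k. x ^ k / real (Suc k)) sums (ln (1 / (1 - x)) / x)"
proof -
  have "summable (\<lambda>k. x ^ k / real (Suc k))"
  proof (rule summable_comparison_test')
    show "summable (\<lambda>k. x ^ k)" using x by simp
    show "norm (x ^ k / real (Suc k)) \<le> x ^ k" for k
      using x by (simp add: divide_simps)
  qed
  then have "(\<lambda>k. - x * (x ^ k / real (Suc k))) sums (- x * (\<Sum>k. x ^ k / real (Suc k)))"
    by (intro sums_mult summable_sums)
  moreover have "(\<lambda>k. (- 1) ^ k * (1 / real (k + 1)) * (1 - x - 1) ^ Suc k) =
      (\<lambda>k. - x * (x ^ k / real (Suc k)))"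
  proof
    fix k
    have "(- 1) ^ k * (- x) ^ k = x ^ k"
      by (simp add: power_mult_distrib[symmetric])
    then show "(- 1) ^ k * (1 / real (k + 1)) * (1 - x - 1) ^ Suc k = - x * (x ^ k / real (Suc k))"
      by (simp add: field_simps)
  qed
  ultimately have "ln (1 - x) = - x * (\<Sum>k. x ^ k / real (Suc k))"
    using ln_series[of "1 - x"] x by (simp add: sums_iff)
  then have "(\<Sum>k. x ^ k / real (Suc k)) = ln (1 / (1 - x)) / x"
    using x by (simp add: ln_div field_simps)
  with \<open>summable (\<lambda>k. x ^ k / real (Suc k))\<close> show ?thesis
    by (simp add: sums_iff)
qed

lemma log_weights:
  fixes p :: real
  assumes "0 < p" "p < 1"
  shows "(\<lambda>k. p ^ k / real (Suc k)) \<longlonglongrightarrow> 0"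
    "p ^ Suc k / real (Suc (Suc k)) = p ^ k / real (Suc k) * (p * (real (Suc k) / real (Suc (Suc k))))"
  using sums_summable[OF log_sums[OF assms]] by (simp_all add: summable_LIMSEQ_zero del: of_nat_Suc)

lemma realizes_log: "realizes log_prog (\<lambda>x. (1 - x) * ln (1 / (1 - x)))"
proof (rule realizesI)
  show "checked [0, 0, 1] log_prog"
    by code_simp
  fix p :: real assume p: "0 < p" "p < 1"
  define w where "w k = chance_at p log_prog 1 (Suc k)" for k
  have query: "chance_at p log_prog 1 n = p * chance_at p log_prog 2 (Suc n) + (1 - p)" for n
    by (subst chance_Query[OF p, of 1 _ True "Out True" "Goto 2 Incr"])
       (simp_all add: bias_def chance_Inr[OF p], simp_all add: log_prog_def)
  have coin: "chance_at p log_prog 2 (Suc (Suc k)) = real (Suc k) / real (Suc (Suc k)) * w (Suc k)" for k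
    by (subst chance_Coin[OF p, of 2 _ False "Goto 1 Keep" "Out False" "Suc (Suc k)"])
       (simp_all add: w_def chance_Inr[OF p] denominator_def field_simps, simp_all add: log_prog_def)
  have "(\<lambda>k. p ^ k / real (Suc k) * (1 - p)) sums w 0"
  proof (rule horner_sums[where K = 1])
    show "w k = (1 - p) + p * (real (Suc k) / real (Suc (Suc k))) * w (Suc k)" for k
      using query[of "Suc k"] coin[of k] by (simp add: w_def)
    show "\<bar>w k\<bar> \<le> 1" for k
      by (simp add: w_def chance_bounds)
  qed (rule log_weights[OF p] | simp)+
  then have "w 0 = ln (1 / (1 - p)) / p * (1 - p)"
    by (rule sums_unique2) (rule sums_mult2[OF log_sums[OF p]])
  moreover have "chance p (transition log_prog) (Inl (0, 0, 0)) = p * w 0"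
    by (subst chance_Query[OF p, of 0 _ True "Out False" "Goto 1 Incr"])
       (simp_all add: bias_def chance_Inr[OF p] w_def, simp_all add: log_prog_def)
  ultimately show "chance p (transition log_prog) (Inl (0, 0, 0)) = (1 - p) * ln (1 / (1 - p))"
    using p by simp
qed

text \<open>
  Subtracting the unknown \<open>z\<close> from the chances removes the restarts from the recurrence.  Since the
  chance at level 1 is \<open>z\<close> itself, the resulting series must vanish, which determines \<open>z\<close>.
\<close>

lemma realizes_log_ratio: "realizes log_ratio_prog (\<lambda>x. x / ln (1 / (1 - x)))"
proof (rule realizesI)
  show "checked [1, 0, 2, 0] log_ratio_prog"
    by code_simp
  fix p :: real assume p: "0 < p" "p < 1"
  define z where "z = chance_at p log_ratio_prog 0 0"
  define u where "u k = (if k = 0 then chance_at p log_ratio_prog 1 1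
    else chance_at p log_ratio_prog 3 (Suc k))" for k
  have start: "chance p (transition log_ratio_prog) (Inl (0, 0, v)) = p * u 0 + (1 - p) * z" for v
    by (subst chance_Query[OF p, of 0 _ True "Goto 0 Keep" "Goto 1 Incr"])
       (simp_all add: bias_def z_def u_def, simp_all add: log_ratio_prog_def)
  have u0: "u 0 = z"
    using start[of 1] p unfolding z_def[symmetric] by (simp add: algebra_simps)
  have query1: "chance_at p log_ratio_prog 1 n = p * chance_at p log_ratio_prog 2 (Suc n) + (1 - p)" for n
    by (subst chance_Query[OF p, of 1 _ True "Out True" "Goto 2 Incr"])
       (simp_all add: bias_def chance_Inr[OF p], simp_all add: log_ratio_prog_def)
  have query3: "chance_at p log_ratio_prog 3 n = p * chance_at p log_ratio_prog 2 (Suc n)" for n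
    by (subst chance_Query[OF p, of 3 _ True "Out False" "Goto 2 Incr"])
       (simp_all add: bias_def chance_Inr[OF p], simp_all add: log_ratio_prog_def)
  have "chance_at p log_ratio_prog 2 (Suc (Suc k)) =
      (1 - 1 / real (Suc (Suc k))) * u (Suc k) + 1 / real (Suc (Suc k)) * z" for k
    by (subst chance_Coin[OF p, of 2 _ False "Goto 3 Keep" "Goto 0 Reset" "Suc (Suc k)"])
       (simp_all add: u_def z_def denominator_def, simp_all add: log_ratio_prog_def)
  moreover have "1 - 1 / real (Suc (Suc k)) = real (Suc k) / real (Suc (Suc k))"
      "1 / real (Suc (Suc k)) = 1 - real (Suc k) / real (Suc (Suc k))" for k
    by (simp_all add: field_simps)
  ultimately have coin: "chance_at p log_ratio_prog 2 (Suc (Suc k)) =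
      z + real (Suc k) / real (Suc (Suc k)) * (u (Suc k) - z)" for k
    by (simp add: right_diff_distrib left_diff_distrib del: of_nat_Suc)
  have A: "(\<lambda>k. p ^ k / real (Suc k) * ((1 - p) * ((if k = 0 then 1 else 0) - z))) sums (u 0 - z)"
  proof (rule horner_sums[where w = "\<lambda>k. u k - z" and K = 1])
    fix k
    have "u k = p * chance_at p log_ratio_prog 2 (Suc (Suc k)) + (1 - p) * (if k = 0 then 1 else 0)"
      using query1[of 1] query3[of "Suc k"] by (cases k) (simp_all add: u_def)
    then show "u k - z = (1 - p) * ((if k = 0 then 1 else 0) - z) +
        p * (real (Suc k) / real (Suc (Suc k))) * (u (Suc k) - z)"
      unfolding coin by (simp add: algebra_simps del: of_nat_Suc)
    have "0 \<le> u k" "u k \<le> 1" "0 \<le> z" "z \<le> 1"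
      by (simp_all add: u_def z_def chance_bounds)
    then show "\<bar>u k - z\<bar> \<le> 1" by linarith
  qed (rule log_weights[OF p] | simp)+
  have B: "(\<lambda>k. (if k = 0 then 1 - p else 0) - (1 - p) * z * (p ^ k / real (Suc k))) sums
      ((1 - p) - (1 - p) * z * (ln (1 / (1 - p)) / p))"
    by (intro sums_diff sums_mult log_sums[OF p] sums_single)
  have eq: "(\<lambda>k. (if k = 0 then 1 - p else 0) - (1 - p) * z * (p ^ k / real (Suc k))) =
      (\<lambda>k. p ^ k / real (Suc k) * ((1 - p) * ((if k = 0 then 1 else 0) - z)))"
  proof
    fix k
    define q where "q = p ^ k / real (Suc k)"
    have "q = 1" if "k = 0" using that by (simp add: q_def)
    then show "(if k = 0 then 1 - p else 0) - (1 - p) * z * (p ^ k / real (Suc k)) =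
        p ^ k / real (Suc k) * ((1 - p) * ((if k = 0 then 1 else 0) - z))"
      unfolding q_def[symmetric] by (cases "k = 0") (simp_all add: algebra_simps)
  qed
  have "u 0 - z = (1 - p) - (1 - p) * z * (ln (1 / (1 - p)) / p)"
    by (rule sums_unique2[OF A B[unfolded eq]])
  then have "(1 - p) * (1 - z * (ln (1 / (1 - p)) / p)) = 0"
    using u0 by (simp add: algebra_simps)
  then have "z * (ln (1 / (1 - p)) / p) = 1"
    using p by simp
  then have "z * ln (1 / (1 - p)) = p"
    using p by simp
  moreover have "0 < ln (1 / (1 - p))"
    using p by (intro ln_gt_zero) (simp add: field_simps)
  ultimately have "z = p / ln (1 / (1 - p))"
    by (simp add: field_simps)
  then show "chance p (transition log_ratio_prog) (Inl (0, 0, 0)) = p / ln (1 / (1 - p))"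
    using start[of 0] start[of 1] by (simp add: z_def)
qed

section \<open>The functions take values between 0 and 1\<close>

lemma exp_tail_unit:
  fixes x :: real
  assumes x: "0 < x" "x < 1"
  shows "0 < (1 - x) * exp x \<and> (1 - x) * exp x < 1"
proof -
  have "1 - x < exp (- x)"
    using x by (simp add: exp_minus_greater)
  then show ?thesis
    using x by (simp add: exp_minus field_simps)
qed

lemma log_unit:
  fixes x :: real
  assumes x: "0 < x" "x < 1"
  shows "x < ln (1 / (1 - x))" "(1 - x) * ln (1 / (1 - x)) < 1"
proof -
  have "ln (1 - x) < ln (exp (- x))"
    using x by (subst ln_less_cancel_iff) (simp_all add: exp_minus_greater)
  then show "x < ln (1 / (1 - x))"
    using x by (simp add: ln_div)
  have "ln (1 / (1 - x)) \<le> 1 / (1 - x) - 1"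
    using x by (intro ln_le_minus_one) auto
  then have "(1 - x) * ln (1 / (1 - x)) \<le> (1 - x) * (1 / (1 - x) - 1)"
    using x by (intro mult_left_mono) auto
  also have "\<dots> = x" using x by (simp add: field_simps)
  finally show "(1 - x) * ln (1 / (1 - x)) < 1" using x by simp
qed

lemma one_minus_less_cos:
  fixes x :: real
  assumes x: "0 < x" "x < 1"
  shows "1 - x < cos x"
proof -
  have "cos x = 1 - 2 * (sin (x / 2))\<^sup>2"
    using cos_double_sin[of "x / 2"] by simp
  moreover have "(sin (x / 2))\<^sup>2 \<le> (x / 2)\<^sup>2"
    using x sin_x_le_x[of "x / 2"] sin_unit_pos[of "x / 2"] by (intro power_mono) auto
  moreover have "x\<^sup>2 < x"
    using x by (simp add: power2_eq_square)
  ultimately show ?thesis using x by (simp add: power_divide)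
qed

lemma less_tan:
  fixes x :: real
  assumes x: "0 < x" "x < 1"
  shows "x < tan x"
proof -
  have "sin 0 - 0 * cos 0 < sin x - x * cos x"
  proof (rule DERIV_pos_imp_increasing_open[OF x(1), where f = "\<lambda>t. sin t - t * cos t"])
    fix t assume t: "0 < t" "t < x"
    have "((\<lambda>t. sin t - t * cos t) has_real_derivative t * sin t) (at t)"
      by (auto intro!: derivative_eq_intros)
    then show "\<exists>y. ((\<lambda>t. sin t - t * cos t) has_real_derivative y) (at t) \<and> 0 < y"
      using t x sin_unit_pos[of t] by (intro exI[of _ "t * sin t"]) auto
  qed (intro continuous_intros)
  then show ?thesis
    using cos_unit_pos[OF x] by (simp add: tan_def field_simps)
qed

theorem theorem2p3:
  "strongly_realizable (\<lambda>x::real. exp (- x)) \<and>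
   strongly_realizable (\<lambda>x::real. exp (x - 1)) \<and>
   strongly_realizable (\<lambda>x::real. (1 - x) * exp x) \<and>
   strongly_realizable (\<lambda>x::real. x * exp (1 - x)) \<and>
   strongly_realizable (\<lambda>x::real. x / ln (1 / (1 - x))) \<and>
   strongly_realizable (\<lambda>x::real. (1 - x) / ln (1 / x)) \<and>
   strongly_realizable (\<lambda>x::real. (1 - x) * ln (1 / (1 - x))) \<and>
   strongly_realizable (\<lambda>x::real. x * ln (1 / x)) \<and>
   strongly_realizable (\<lambda>x::real. cos x) \<and>
   strongly_realizable (\<lambda>x::real. (1 - x) / cos x) \<and>
   strongly_realizable (\<lambda>x::real. x / tan x) \<and>
   strongly_realizable (\<lambda>x::real. (1 - x) * tan x)"
proof (intro conjI)
  have exp_unit: "0 < exp (- x) \<and> exp (- x) < 1" if "0 < x" "x < 1" for x :: real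
    using that by simp
  have ratio_unit: "0 < x / ln (1 / (1 - x)) \<and> x / ln (1 / (1 - x)) < 1" if "0 < x" "x < 1" for x :: real
    using that log_unit(1)[OF that] by simp
  have entropy_unit: "0 < (1 - x) * ln (1 / (1 - x)) \<and> (1 - x) * ln (1 / (1 - x)) < 1"
    if "0 < x" "x < 1" for x :: real
    using that log_unit[OF that] by (intro conjI mult_pos_pos) linarith+
  have mirrored: "strongly_realizable (\<lambda>x. \<phi> (1 - x))"
    if "realizes Q \<phi>" "\<And>x. 0 < x \<Longrightarrow> x < 1 \<Longrightarrow> 0 < \<phi> x \<and> \<phi> x < 1" for Q \<phi>
    using realizes_mirror[OF that(1)] that(2) by (intro realizes_imp_strongly_realizable) auto
  show "strongly_realizable (\<lambda>x::real. exp (- x))"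
    by (rule realizes_imp_strongly_realizable[OF realizes_exp exp_unit])
  show "strongly_realizable (\<lambda>x::real. exp (x - 1))"
    using mirrored[OF realizes_exp exp_unit] by simp
  show "strongly_realizable (\<lambda>x::real. (1 - x) * exp x)"
    by (rule realizes_imp_strongly_realizable[OF realizes_exp_tail exp_tail_unit])
  show "strongly_realizable (\<lambda>x::real. x * exp (1 - x))"
    using mirrored[OF realizes_exp_tail exp_tail_unit] by simp
  show "strongly_realizable (\<lambda>x::real. x / ln (1 / (1 - x)))"
    by (rule realizes_imp_strongly_realizable[OF realizes_log_ratio ratio_unit])
  show "strongly_realizable (\<lambda>x::real. (1 - x) / ln (1 / x))"
    using mirrored[OF realizes_log_ratio ratio_unit] by simp
  show "strongly_realizable (\<lambda>x::real. (1 - x) * ln (1 / (1 - x)))"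
    by (rule realizes_imp_strongly_realizable[OF realizes_log entropy_unit])
  show "strongly_realizable (\<lambda>x::real. x * ln (1 / x))"
    using mirrored[OF realizes_log entropy_unit] by simp
  show "strongly_realizable (\<lambda>x::real. cos x)"
  proof (rule realizes_imp_strongly_realizable[OF realizes_cos])
    fix x :: real assume x: "0 < x" "x < 1"
    have "cos x < cos 0"
      using x pi_gt3 by (intro cos_monotone_0_pi) auto
    then show "0 < cos x \<and> cos x < 1" using cos_unit_pos[OF x] by simp
  qed
  show "strongly_realizable (\<lambda>x::real. (1 - x) / cos x)"
  proof (rule realizes_imp_strongly_realizable[OF realizes_sec])
    fix x :: real assume x: "0 < x" "x < 1"
    then show "0 < (1 - x) / cos x \<and> (1 - x) / cos x < 1"
      using one_minus_less_cos[OF x] cos_unit_pos[OF x] by simp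
  qed
  show "strongly_realizable (\<lambda>x::real. x / tan x)"
  proof (rule realizes_imp_strongly_realizable[OF realizes_cot])
    fix x :: real assume x: "0 < x" "x < 1"
    then show "0 < x / tan x \<and> x / tan x < 1"
      using less_tan[OF x] by simp
  qed
  show "strongly_realizable (\<lambda>x::real. (1 - x) * tan x)"
  proof (rule realizes_imp_strongly_realizable[OF realizes_tan])
    fix x :: real assume x: "0 < x" "x < 1"
    have "(1 - x) / cos x < 1"
      using one_minus_less_cos[OF x] cos_unit_pos[OF x] by simp
    then have "(1 - x) / cos x * sin x < 1 * sin x"
      using sin_unit_pos[OF x] by (intro mult_strict_right_mono) auto
    also have "\<dots> \<le> 1" by simp
    finally show "0 < (1 - x) * tan x \<and> (1 - x) * tan x < 1"
      using x sin_unit_pos[OF x] cos_unit_pos[OF x] by (simp add: tan_def)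
  qed
qed

end
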